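(* Consider the Vantage protocol specified in the context. Suppose every party is correct and $v$ is past the all-correct pacemaker cutoff. Let $\beta_u$ denote the time $B_u$ is sent. Then \[ \beta_{v+1}\le\max_{u\le v}\beta_u+\delta , \] so the least not-yet-proposed view always follows within $\delta$ of the latest send. Call $B_v$ prefix-extending when every lower view was sent by $\beta_v$. Suppose $B_v=(C_v,T_v)$ is prefix-extending and the $\mathsf{AuthorOK}$ and tip-anchoring checks for $B_v$ pass at every party by $\beta_v+\delta$. Then every correct party obtains the ordinary Direct AGB full result $\mathsf{commit\text{-}full}(C_v,T_v)$ by $\beta_v+3\delta$, and every correct party also emits and submits the Vantage fast result $\mathsf{commit\text{-}full}(C_v,T_v)$ by $\beta_v+2\delta$. (The send times need not be monotone in the view number.)
   Context: Model. Parties $p_1,\dots,p_n$, $n\ge3f+1$; here all are correct. $Q=n-f$. Reliable authenticated point-to-point channels; a broadcast includes the sender, which delivers to itself immediately. All counts are over distinct authors of messages received directly from those authors. Partial synchrony: with unknown GST, a message sent at time $t$ arrives by $\max(t,\mathrm{GST})+\delta$, where $\delta\le\Delta$ and $\Delta$ is known. After GST local clocks measure elapsed real time without drift. At a local deadline a party processes every message delivered by that deadline, and evaluates the positive rules they enable, before taking the timeout rule. Executions are fair and non-Zeno. Data. Each party publishes hash-linked blocks on its own lane by $\mathsf{publish}$ messages to all. References $(a,k,h)$ name lane prefixes of author $p_a$. $\mathsf{DirectPub}_j(a,k,h)$: $p_j$ holds the valid lane prefix ending at $h$ and received all its blocks in $\mathsf{publish}$ messages directly from $p_a$. Parties attach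 to proposal ECHOs acknowledgments of named prefixes that they hold directly published. $\mathsf{AuthorOK}_j(a,k,h)$: $\mathsf{DirectPub}_j(a,k,h)$ or $p_j$ has counted acknowledgments of $(a,k,h)$ from $f+1$ parties; for a manifest, every entry. Tip anchoring of $(C,T)$ at $p_i$: for every author present in both manifests, $p_i$ holds the full lane prefix of the tip entry and it strictly contains the author's core entry. Direct AGB in view $v$. Proposer: $\mathsf{Proposer}(v)=p_{1+((v-1)\bmod n)}$. A proposal is $B_v=(C,T)$ (core and tip manifest); well-formedness is syntactic and correct proposers send exactly one proposal, which is well formed. $\mathsf{CoreOK}_i(C)=\mathsf{AuthorOK}_i(C)$; $\mathsf{TipOK}_i(C,T)$ is $\mathsf{AuthorOK}_i(T)$ plus tip anchoring; both persistent. $\theta_E=3\Delta$, $\theta_R=4\Delta$; $e_i(v)$ is $p_i$'s entry time. (R2) $p_i$ fixes the first view-$v$ proposal received directly from the proposer (even if it arrives after the echo deadline). A fixed well-formed proposal is active once $p_i$ activates or enters $v$. While its echo-stage response is pending and the proposal is active, as soon as $\mathsf{CoreOK}_i(C)$ and $\mathsf{TipOK}_i(C,T)$ hold it broadcasts a grade-1 ECHO. After entry, with $t$ the later of entry and direct receipt, if nothing was sent by the end of $[t,\min\{t+\Delta,e_i(v)+\theta_E\}]$ it broadcasts a grade-0 ECHO if $\mathsf{CoreOK}_i(C)$ holds and $\mathsf{echo\text{-}skip}$ otherwise. If no well-formed proposal is active by $e_i(v)+\theta_E$ it broadcasts $\mathsf{echo\text{-}skip}$. One echo-stage response per view. (R3)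 Independently of entry, while its initial ready-stage response is pending: upon counting $Q$ ECHOs (any grades) naming one $B$, $p_i$ broadcasts READY for $B$ with grade 1 (resp. 0) if it has counted $Q$ grade-1 (resp. grade-0) ECHOs for $B$, and grade mix otherwise (a mix READY may be refined once to a homogeneous READY for the same $B$ if one grade reaches $Q$ ECHOs before all $n$ echo-stage responses are counted and before $e_i(v)+\theta_R$). If it has entered and sent no READY by $e_i(v)+\theta_R$ it broadcasts $\mathsf{no\text{-}ready}$. (R4) Upon counting $Q$ READYs for a common $B=(C,T)$, $p_i$ completes $v$; $Q$ grade-1 READYs for $B$ give the ordinary Direct AGB full result $\mathsf{commit\text{-}full}(C,T)$; $Q$ grade-0 ones give $\mathsf{commit\text{-}core}(C)$. Fast result: a party that has counted grade-1 ECHOs for one $B=(C,T)$ from all $n$ parties emits and submits $\mathsf{commit\text{-}full}(C,T)$. Pacemaker. $p_i$ stores the largest directly received WISH value $\omega_i[j]$ of each $p_j$ (initially 0); $\omega_i^+$ and $\omega_i^Q$ are the $(f+1)$st and $Q$th largest entries. Genesis enters view 1 and broadcasts WISH 2; responses for views $\le0$ are fixed. When $\omega_i^+$ exceeds its own largest wish, $p_i$ broadcasts a WISH for $\omega_i^+$; when $\omega_i^Q$ increases it enters all missing views up to $\omega_i^Q$ immediately in order. Before sending whichever of its echo-stage response for $v-1$ and initial ready-stage response for $v-2$ completes that pair, $p_i$ raises its own wish to at least $v+1$ (piggybacked on responses). Responsive frontier $a_i$, initially 0: entering $v$ raises $a_i$ to at least $v-1$; when the fixed proposal of view $a_i+1$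 is well formed, $a_i$ increases by one and that view is activated (repeatedly, buffered proposals in increasing order). $\mathsf{Proposer}(v)$ broadcasts its proposal once, as soon as $a_i\ge v-1$ or $\omega_i^+\ge v$. All-correct pacemaker cutoff: a finite view $V$, larger than every view entered, proposed, responded to or wished for by a correct party before GST, such that for every $v\ge V$, if the first entry to $v$ occurs at $s_v$, every party enters $v$ by $s_v+\delta$ (such $V$ exists when all parties are correct); "past the cutoff" means $v\ge V$. *)

theory Defs
  imports Complex_Main
begin

section \<open>Data and messages\<close>

type_synonym party = nat
type_synonym view = nat

datatype ('h, 'p) block =
  Block (author: party) (height: nat) (parent: 'h) (payload: 'p)

text \<open>A reference \<open>(a, l, h)\<close> names the prefix of length \<open>l\<close> of the lane of \<open>a\<close> whose last block
  hashes to \<open>h\<close>. A manifest has at most one entry per author.\<close>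

type_synonym 'h lref = "party \<times> nat \<times> 'h"
type_synonym 'h manifest = "party \<Rightarrow> (nat \<times> 'h) option"
type_synonym 'h proposal = "'h manifest \<times> 'h manifest"

definition entries :: "'h manifest \<Rightarrow> 'h lref set" where
  "entries M = {(a, l, h). M a = Some (l, h)}"

datatype grade = Grade0 | Grade1
datatype ready_grade = Homogeneous grade | Mix

text \<open>The last argument of a response is the sender's own wish, piggybacked on it; the set
  in an \<open>Echo\<close> holds the attached acknowledgments.\<close>

datatype ('h, 'p) msg =
    Publish "('h, 'p) block"
  | Proposal view "'h proposal"
  | Echo view grade "'h proposal" "'h lref set" nat
  | EchoSkip view nat
  | Ready view ready_grade "'h proposal" nat
  | NoReady view nat
  | Wish nat

fun wish_of :: "('h, 'p) msg \<Rightarrow> nat option" where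
  "wish_of (Wish w) = Some w"
| "wish_of (Echo v g B A w) = Some w"
| "wish_of (EchoSkip v w) = Some w"
| "wish_of (Ready v g B w) = Some w"
| "wish_of (NoReady v w) = Some w"
| "wish_of (Publish b) = None"
| "wish_of (Proposal v B) = None"

definition is_echo_response :: "view \<Rightarrow> ('h, 'p) msg \<Rightarrow> bool" where
  "is_echo_response v m \<longleftrightarrow> (\<exists>g B A w. m = Echo v g B A w) \<or> (\<exists>w. m = EchoSkip v w)"

definition is_ready_response :: "view \<Rightarrow> ('h, 'p) msg \<Rightarrow> bool" where
  "is_ready_response v m \<longleftrightarrow> (\<exists>g B w. m = Ready v g B w) \<or> (\<exists>w. m = NoReady v w)"

datatype 'h outcome = CommitFull "'h manifest" "'h manifest" | CommitCore "'h manifest"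


section \<open>Runs\<close>

text \<open>A run is an infinite sequence of instantaneous events with real time stamps; several
  events may share a time stamp, and their order in the sequence is then their causal order.
  \<open>Deliver s i\<close> delivers to \<open>i\<close> the message broadcast in step \<open>s\<close>; a broadcast needs no
  delivery event for its sender. \<open>Obtain i b\<close> covers every way of getting hold of a block
  other than a \<open>Publish\<close> message. \<open>Idle\<close> only lets time pass.\<close>

datatype ('h, 'p) event =
    Genesis party
  | Bcast party "('h, 'p) msg"
  | Deliver nat party
  | Obtain party "('h, 'p) block"
  | Enter party view
  | Activate party view
  | Complete party view
  | DirectResult party view "'h outcome"
  | EmitFast party view "'h outcome"
  | SubmitFast party view "'h outcome"
  | Idle

record ('h, 'p) run =
  nparties :: nat                             \<comment> \<open>\<open>n\<close>\<close>
  nfaults :: nat                              \<comment> \<open>\<open>f\<close>\<close>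
  max_delay :: real                           \<comment> \<open>the known bound \<open>\<Delta>\<close>\<close>
  hash :: "('h, 'p) block \<Rightarrow> 'h"
  root_hash :: 'h                             \<comment> \<open>parent hash of the first block of a lane\<close>
  well_formed :: "view \<Rightarrow> 'h proposal \<Rightarrow> bool"
  gst :: real
  delay :: real                               \<comment> \<open>the actual bound \<open>\<delta>\<close>\<close>
  clock :: "party \<Rightarrow> real \<Rightarrow> real"              \<comment> \<open>local clock reading at a real time\<close>
  event :: "nat \<Rightarrow> ('h, 'p) event"
  etime :: "nat \<Rightarrow> real"                       \<comment> \<open>real time of the event\<close>

definition parties :: "('h, 'p) run \<Rightarrow> party set" where
  "parties R = {1..nparties R}"

definition quorum :: "('h, 'p) run \<Rightarrow> nat" where
  "quorum R = nparties R - nfaults R"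

definition proposer :: "('h, 'p) run \<Rightarrow> view \<Rightarrow> party" where
  "proposer R v = 1 + ((v - 1) mod nparties R)"

text \<open>Genesis enters view 1 and broadcasts \<open>Wish 2\<close>.\<close>

definition sends :: "('h, 'p) run \<Rightarrow> nat \<Rightarrow> party \<Rightarrow> ('h, 'p) msg \<Rightarrow> bool" where
  "sends R s i m \<longleftrightarrow> event R s = Bcast i m \<or> (event R s = Genesis i \<and> m = Wish 2)"

definition enters :: "('h, 'p) run \<Rightarrow> nat \<Rightarrow> party \<Rightarrow> view \<Rightarrow> bool" where
  "enters R s i v \<longleftrightarrow> event R s = Enter i v \<or> (event R s = Genesis i \<and> v = 1)"

text \<open>\<open>receives R s i j m\<close>: in step \<open>s\<close>, \<open>i\<close> receives \<open>m\<close> directly from \<open>j\<close>. The first disjunct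
  is the immediate self-delivery.\<close>

definition receives :: "('h, 'p) run \<Rightarrow> nat \<Rightarrow> party \<Rightarrow> party \<Rightarrow> ('h, 'p) msg \<Rightarrow> bool" where
  "receives R s i j m \<longleftrightarrow>
     (j = i \<and> sends R s i m) \<or> (\<exists>s'. event R s = Deliver s' i \<and> sends R s' j m)"


section \<open>Local state\<close>

text \<open>All state is read off the history: an argument \<open>k\<close> denotes the state before step \<open>k\<close>,
  that is, after the steps \<open>s < k\<close>.\<close>

definition started :: "('h, 'p) run \<Rightarrow> nat \<Rightarrow> party \<Rightarrow> bool" where
  "started R k i \<longleftrightarrow> (\<exists>s<k. event R s = Genesis i)"

definition sent :: "('h, 'p) run \<Rightarrow> nat \<Rightarrow> party \<Rightarrow> ('h, 'p) msg \<Rightarrow> bool" where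
  "sent R k i m \<longleftrightarrow> (\<exists>s<k. sends R s i m)"

definition received :: "('h, 'p) run \<Rightarrow> nat \<Rightarrow> party \<Rightarrow> party \<Rightarrow> ('h, 'p) msg \<Rightarrow> bool" where
  "received R k i j m \<longleftrightarrow> (\<exists>s<k. receives R s i j m)"

definition entered :: "('h, 'p) run \<Rightarrow> nat \<Rightarrow> party \<Rightarrow> view \<Rightarrow> bool" where
  "entered R k i v \<longleftrightarrow> (\<exists>s<k. enters R s i v)"

definition activated :: "('h, 'p) run \<Rightarrow> nat \<Rightarrow> party \<Rightarrow> view \<Rightarrow> bool" where
  "activated R k i v \<longleftrightarrow> (\<exists>s<k. event R s = Activate i v)"

definition entry_clock :: "('h, 'p) run \<Rightarrow> party \<Rightarrow> view \<Rightarrow> real" where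
  "entry_clock R i v = clock R i (etime R (LEAST s. enters R s i v))"


subsection \<open>Lanes\<close>

definition end_hash :: "('h, 'p) run \<Rightarrow> ('h, 'p) block list \<Rightarrow> 'h" where
  "end_hash R bs = (if bs = [] then root_hash R else hash R (last bs))"

definition lane_prefix :: "('h, 'p) run \<Rightarrow> 'h lref \<Rightarrow> ('h, 'p) block list \<Rightarrow> bool" where
  "lane_prefix R = (\<lambda>(a, l, h) bs. length bs = l \<and> end_hash R bs = h \<and>
     (\<forall>x<l. author (bs ! x) = a \<and> height (bs ! x) = Suc x \<and> parent (bs ! x) = end_hash R (take x bs)))"

definition holds :: "('h, 'p) run \<Rightarrow> nat \<Rightarrow> party \<Rightarrow> ('h, 'p) block \<Rightarrow> bool" where
  "holds R k i b \<longleftrightarrow> (\<exists>s<k. event R s = Obtain i b) \<or> (\<exists>j. received R k i j (Publish b))"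

definition direct_pub :: "('h, 'p) run \<Rightarrow> nat \<Rightarrow> party \<Rightarrow> 'h lref \<Rightarrow> bool" where
  "direct_pub R k j r \<longleftrightarrow> (\<exists>bs. lane_prefix R r bs \<and>
     (\<forall>b \<in> set bs. holds R k j b \<and> received R k j (fst r) (Publish b)))"

definition acknowledged :: "('h, 'p) run \<Rightarrow> nat \<Rightarrow> party \<Rightarrow> party \<Rightarrow> 'h lref \<Rightarrow> bool" where
  "acknowledged R k i j r \<longleftrightarrow> (\<exists>v g B A w. received R k i j (Echo v g B A w) \<and> r \<in> A)"

definition author_ok :: "('h, 'p) run \<Rightarrow> nat \<Rightarrow> party \<Rightarrow> 'h lref \<Rightarrow> bool" where
  "author_ok R k i r \<longleftrightarrow>
     direct_pub R k i r \<or> nfaults R + 1 \<le> card {j \<in> parties R. acknowledged R k i j r}"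

definition manifest_author_ok :: "('h, 'p) run \<Rightarrow> nat \<Rightarrow> party \<Rightarrow> 'h manifest \<Rightarrow> bool" where
  "manifest_author_ok R k i M \<longleftrightarrow> (\<forall>r \<in> entries M. author_ok R k i r)"

definition tip_anchored ::
    "('h, 'p) run \<Rightarrow> nat \<Rightarrow> party \<Rightarrow> 'h manifest \<Rightarrow> 'h manifest \<Rightarrow> bool" where
  "tip_anchored R k i C T \<longleftrightarrow> (\<forall>a lc hc lt ht. C a = Some (lc, hc) \<and> T a = Some (lt, ht) \<longrightarrow>
     (\<exists>bs. lane_prefix R (a, lt, ht) bs \<and> (\<forall>b \<in> set bs. holds R k i b) \<and>
           lc < lt \<and> lane_prefix R (a, lc, hc) (take lc bs)))"

definition core_ok :: "('h, 'p) run \<Rightarrow> nat \<Rightarrow> party \<Rightarrow> 'h manifest \<Rightarrow> bool" where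
  "core_ok R k i C \<longleftrightarrow> manifest_author_ok R k i C"

definition tip_ok :: "('h, 'p) run \<Rightarrow> nat \<Rightarrow> party \<Rightarrow> 'h manifest \<Rightarrow> 'h manifest \<Rightarrow> bool" where
  "tip_ok R k i C T \<longleftrightarrow> manifest_author_ok R k i T \<and> tip_anchored R k i C T"

definition acks :: "('h, 'p) run \<Rightarrow> nat \<Rightarrow> party \<Rightarrow> 'h proposal \<Rightarrow> 'h lref set" where
  "acks R k i B = {r \<in> entries (fst B) \<union> entries (snd B). direct_pub R k i r}"


subsection \<open>Pacemaker state\<close>

definition omega :: "('h, 'p) run \<Rightarrow> nat \<Rightarrow> party \<Rightarrow> party \<Rightarrow> nat" where
  "omega R k i j = Max ({0} \<union> {w. \<exists>m. received R k i j m \<and> wish_of m = Some w})"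

definition omega_rank :: "('h, 'p) run \<Rightarrow> nat \<Rightarrow> party \<Rightarrow> nat \<Rightarrow> nat" where
  "omega_rank R k i r = rev (sort (map (omega R k i) [1..<Suc (nparties R)])) ! (r - 1)"

definition omega_plus :: "('h, 'p) run \<Rightarrow> nat \<Rightarrow> party \<Rightarrow> nat" where
  "omega_plus R k i = omega_rank R k i (nfaults R + 1)"

definition omega_Q :: "('h, 'p) run \<Rightarrow> nat \<Rightarrow> party \<Rightarrow> nat" where
  "omega_Q R k i = omega_rank R k i (quorum R)"

definition own_wish :: "('h, 'p) run \<Rightarrow> nat \<Rightarrow> party \<Rightarrow> nat" where
  "own_wish R k i = Max ({0} \<union> {w. \<exists>m. sent R k i m \<and> wish_of m = Some w})"

definition frontier :: "('h, 'p) run \<Rightarrow> nat \<Rightarrow> party \<Rightarrow> nat" where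
  "frontier R k i =
     Max ({0} \<union> {v - 1 | v. entered R k i v} \<union> {v. activated R k i v})"

definition echo_done :: "('h, 'p) run \<Rightarrow> nat \<Rightarrow> party \<Rightarrow> view \<Rightarrow> bool" where
  "echo_done R k i v \<longleftrightarrow> (\<exists>m. sent R k i m \<and> is_echo_response v m)"

definition ready_done :: "('h, 'p) run \<Rightarrow> nat \<Rightarrow> party \<Rightarrow> view \<Rightarrow> bool" where
  "ready_done R k i v \<longleftrightarrow> (\<exists>m. sent R k i m \<and> is_ready_response v m)"

text \<open>The own wish carried by the echo-stage response for \<open>v\<close>, which completes the pair
  \<open>(echo v, ready (v - 1))\<close> if the ready half is done or belongs to view 0; and by the initial
  ready-stage response for \<open>v\<close>, which completes \<open>(echo (v + 1), ready v)\<close> if the echo half is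
  done. Completing the pair of \<open>echo (u - 1)\<close> and \<open>ready (u - 2)\<close> raises the wish to \<open>u + 1\<close>.\<close>

definition echo_wish :: "('h, 'p) run \<Rightarrow> nat \<Rightarrow> party \<Rightarrow> view \<Rightarrow> nat" where
  "echo_wish R k i v =
     (if v = 1 \<or> ready_done R k i (v - 1) then max (own_wish R k i) (v + 2) else own_wish R k i)"

definition ready_wish :: "('h, 'p) run \<Rightarrow> nat \<Rightarrow> party \<Rightarrow> view \<Rightarrow> nat" where
  "ready_wish R k i v =
     (if echo_done R k i (v + 1) then max (own_wish R k i) (v + 3) else own_wish R k i)"


subsection \<open>Direct AGB state\<close>

definition fixes_proposal :: "('h, 'p) run \<Rightarrow> nat \<Rightarrow> party \<Rightarrow> view \<Rightarrow> 'h proposal \<Rightarrow> bool" where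
  "fixes_proposal R s i v B \<longleftrightarrow> receives R s i (proposer R v) (Proposal v B) \<and>
     (\<forall>s'<s. \<forall>B'. \<not> receives R s' i (proposer R v) (Proposal v B'))"

definition fixed_proposal :: "('h, 'p) run \<Rightarrow> nat \<Rightarrow> party \<Rightarrow> view \<Rightarrow> 'h proposal \<Rightarrow> bool" where
  "fixed_proposal R k i v B \<longleftrightarrow> (\<exists>s<k. fixes_proposal R s i v B)"

definition active_proposal :: "('h, 'p) run \<Rightarrow> nat \<Rightarrow> party \<Rightarrow> view \<Rightarrow> 'h proposal \<Rightarrow> bool" where
  "active_proposal R k i v B \<longleftrightarrow> fixed_proposal R k i v B \<and> well_formed R v B \<and>
     (activated R k i v \<or> entered R k i v)"

definition echoes :: "('h, 'p) run \<Rightarrow> nat \<Rightarrow> party \<Rightarrow> view \<Rightarrow> 'h proposal \<Rightarrow> nat" where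
  "echoes R k i v B = card {j \<in> parties R. \<exists>g A w. received R k i j (Echo v g B A w)}"

definition graded_echoes ::
    "('h, 'p) run \<Rightarrow> nat \<Rightarrow> party \<Rightarrow> view \<Rightarrow> grade \<Rightarrow> 'h proposal \<Rightarrow> nat" where
  "graded_echoes R k i v g B = card {j \<in> parties R. \<exists>A w. received R k i j (Echo v g B A w)}"

definition echo_responses :: "('h, 'p) run \<Rightarrow> nat \<Rightarrow> party \<Rightarrow> view \<Rightarrow> nat" where
  "echo_responses R k i v =
     card {j \<in> parties R. \<exists>m. received R k i j m \<and> is_echo_response v m}"

definition readies :: "('h, 'p) run \<Rightarrow> nat \<Rightarrow> party \<Rightarrow> view \<Rightarrow> 'h proposal \<Rightarrow> nat" where
  "readies R k i v B = card {j \<in> parties R. \<exists>g w. received R k i j (Ready v g B w)}"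

definition graded_readies ::
    "('h, 'p) run \<Rightarrow> nat \<Rightarrow> party \<Rightarrow> view \<Rightarrow> grade \<Rightarrow> 'h proposal \<Rightarrow> nat" where
  "graded_readies R k i v g B =
     card {j \<in> parties R. \<exists>w. received R k i j (Ready v (Homogeneous g) B w)}"

definition initial_ready_grade ::
    "('h, 'p) run \<Rightarrow> nat \<Rightarrow> party \<Rightarrow> view \<Rightarrow> 'h proposal \<Rightarrow> ready_grade" where
  "initial_ready_grade R k i v B =
     (if quorum R \<le> graded_echoes R k i v Grade1 B then Homogeneous Grade1
      else if quorum R \<le> graded_echoes R k i v Grade0 B then Homogeneous Grade0
      else Mix)"


section \<open>Protocol rules\<close>

text \<open>The rules a party takes as soon as they are enabled, after its genesis. Views are positive.\<close>

inductive positive_rule :: "('h, 'p) run \<Rightarrow> nat \<Rightarrow> party \<Rightarrow> ('h, 'p) event \<Rightarrow> bool"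
  for R :: "('h, 'p) run" and k :: nat and i :: party where
  enter: "\<lbrakk>1 \<le> v; \<not> entered R k i v; \<forall>u. 1 \<le> u \<and> u < v \<longrightarrow> entered R k i u; v \<le> omega_Q R k i\<rbrakk>
    \<Longrightarrow> positive_rule R k i (Enter i v)"
| amplify: "own_wish R k i < omega_plus R k i
    \<Longrightarrow> positive_rule R k i (Bcast i (Wish (omega_plus R k i)))"
| activate: "\<lbrakk>v = frontier R k i + 1; fixed_proposal R k i v B; well_formed R v B\<rbrakk>
    \<Longrightarrow> positive_rule R k i (Activate i v)"
| propose: "\<lbrakk>1 \<le> v; i = proposer R v; \<nexists>B'. sent R k i (Proposal v B');
      v - 1 \<le> frontier R k i \<or> v \<le> omega_plus R k i\<rbrakk>
    \<Longrightarrow> positive_rule R k i (Bcast i (Proposal v B))"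
| echo: "\<lbrakk>1 \<le> v; \<not> echo_done R k i v; active_proposal R k i v (C, T);
      core_ok R k i C; tip_ok R k i C T\<rbrakk>
    \<Longrightarrow> positive_rule R k i
          (Bcast i (Echo v Grade1 (C, T) (acks R k i (C, T)) (echo_wish R k i v)))"
| ready: "\<lbrakk>1 \<le> v; \<not> ready_done R k i v; quorum R \<le> echoes R k i v B\<rbrakk>
    \<Longrightarrow> positive_rule R k i (Bcast i (Ready v (initial_ready_grade R k i v B) B (ready_wish R k i v)))"
| complete: "\<lbrakk>1 \<le> v; \<nexists>s. s < k \<and> event R s = Complete i v; quorum R \<le> readies R k i v B\<rbrakk>
    \<Longrightarrow> positive_rule R k i (Complete i v)"
| direct_full: "\<lbrakk>1 \<le> v; \<nexists>s. s < k \<and> event R s = DirectResult i v (CommitFull C T);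
      quorum R \<le> graded_readies R k i v Grade1 (C, T)\<rbrakk>
    \<Longrightarrow> positive_rule R k i (DirectResult i v (CommitFull C T))"
| direct_core: "\<lbrakk>1 \<le> v; \<nexists>s. s < k \<and> event R s = DirectResult i v (CommitCore C);
      quorum R \<le> graded_readies R k i v Grade0 (C, T)\<rbrakk>
    \<Longrightarrow> positive_rule R k i (DirectResult i v (CommitCore C))"
| emit_fast: "\<lbrakk>1 \<le> v; \<nexists>s. s < k \<and> event R s = EmitFast i v (CommitFull C T);
      graded_echoes R k i v Grade1 (C, T) = nparties R\<rbrakk>
    \<Longrightarrow> positive_rule R k i (EmitFast i v (CommitFull C T))"
| submit_fast: "\<lbrakk>1 \<le> v; \<nexists>s. s < k \<and> event R s = SubmitFast i v (CommitFull C T);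
      graded_echoes R k i v Grade1 (C, T) = nparties R\<rbrakk>
    \<Longrightarrow> positive_rule R k i (SubmitFast i v (CommitFull C T))"

definition positive :: "('h, 'p) run \<Rightarrow> nat \<Rightarrow> party \<Rightarrow> ('h, 'p) event \<Rightarrow> bool" where
  "positive R k i e \<longleftrightarrow> (if started R k i then positive_rule R k i e else e = Genesis i)"

text \<open>The timeout rules enabled at real time \<open>t\<close> in state \<open>k\<close>. Deadlines are in local clock time;
  \<open>3 * max_delay\<close> and \<open>4 * max_delay\<close> are the timeouts of the two stages. After entry, active
  means fixed and well-formed.\<close>

inductive timeout :: "('h, 'p) run \<Rightarrow> nat \<Rightarrow> real \<Rightarrow> party \<Rightarrow> ('h, 'p) event \<Rightarrow> bool"
  for R :: "('h, 'p) run" and k :: nat and t :: real and i :: party where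
  echo_window: "\<lbrakk>1 \<le> v; entered R k i v; \<not> echo_done R k i v;
      s < k; fixes_proposal R s i v (C, T); well_formed R v (C, T);
      min (max (entry_clock R i v) (clock R i (etime R s)) + max_delay R)
          (entry_clock R i v + 3 * max_delay R) \<le> clock R i t\<rbrakk>
    \<Longrightarrow> timeout R k t i (Bcast i
          (if core_ok R k i C
           then Echo v Grade0 (C, T) (acks R k i (C, T)) (echo_wish R k i v)
           else EchoSkip v (echo_wish R k i v)))"
| echo_absent: "\<lbrakk>1 \<le> v; entered R k i v; \<not> echo_done R k i v; \<nexists>B. active_proposal R k i v B;
      entry_clock R i v + 3 * max_delay R \<le> clock R i t\<rbrakk>
    \<Longrightarrow> timeout R k t i (Bcast i (EchoSkip v (echo_wish R k i v)))"
| no_ready: "\<lbrakk>1 \<le> v; entered R k i v; \<not> ready_done R k i v;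
      entry_clock R i v + 4 * max_delay R \<le> clock R i t\<rbrakk>
    \<Longrightarrow> timeout R k t i (Bcast i (NoReady v (ready_wish R k i v)))"

text \<open>Steps a party may take but need not: publishing the next block of its own lane,
  obtaining a block, and refining a mix READY.\<close>

inductive optional_step :: "('h, 'p) run \<Rightarrow> nat \<Rightarrow> party \<Rightarrow> ('h, 'p) event \<Rightarrow> bool"
  for R :: "('h, 'p) run" and k :: nat and i :: party where
  publish: "\<lbrakk>lane_prefix R (i, height b, hash R b) (bs @ [b]);
      set bs = {b'. sent R k i (Publish b')}\<rbrakk>
    \<Longrightarrow> optional_step R k i (Bcast i (Publish b))"
| obtain_block: "optional_step R k i (Obtain i b)"
| refine: "\<lbrakk>sent R k i (Ready v Mix B w); \<nexists>g' B' w'. sent R k i (Ready v (Homogeneous g') B' w');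
      s < k; quorum R \<le> graded_echoes R (Suc s) i v g B; echo_responses R (Suc s) i v < nparties R;
      entered R (Suc s) i v \<longrightarrow> clock R i (etime R s) < entry_clock R i v + 4 * max_delay R\<rbrakk>
    \<Longrightarrow> optional_step R k i (Bcast i (Ready v (Homogeneous g) B (own_wish R k i)))"

definition delivery :: "('h, 'p) run \<Rightarrow> nat \<Rightarrow> party \<Rightarrow> ('h, 'p) event \<Rightarrow> bool" where
  "delivery R k i e \<longleftrightarrow> (\<exists>s<k. e = Deliver s i \<and> (\<exists>j m. j \<noteq> i \<and> sends R s j m) \<and>
     (\<forall>d<k. event R d \<noteq> Deliver s i))"

text \<open>Events by which a message or block reaches a party other than through its own rules.\<close>

definition input :: "party \<Rightarrow> ('h, 'p) event \<Rightarrow> bool" where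
  "input i e \<longleftrightarrow> (\<exists>s. e = Deliver s i) \<or> (\<exists>b. e = Obtain i b) \<or> (\<exists>b. e = Bcast i (Publish b))"

text \<open>A timeout is taken only when no positive rule is enabled and no input reaches the party
  later at the same time, so everything delivered by the deadline is processed first.\<close>

definition timeout_step :: "('h, 'p) run \<Rightarrow> nat \<Rightarrow> party \<Rightarrow> bool" where
  "timeout_step R k i \<longleftrightarrow> timeout R k (etime R k) i (event R k) \<and> (\<nexists>e. positive R k i e) \<and>
     (\<forall>m>k. etime R m = etime R k \<longrightarrow> \<not> input i (event R m))"

definition legal_step :: "('h, 'p) run \<Rightarrow> nat \<Rightarrow> bool" where
  "legal_step R k \<longleftrightarrow> event R k = Idle \<or>
     (\<exists>i \<in> parties R. positive R k i (event R k) \<or>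
        (started R k i \<and> (timeout_step R k i \<or> optional_step R k i (event R k) \<or>
                          delivery R k i (event R k))))"

text \<open>Runs of the protocol in which all parties are correct. Time passes (from \<open>etime R k\<close>
  towards \<open>etime R (Suc k)\<close>) only while no positive or timeout rule is enabled; with the delivery
  condition this subsumes fairness. Divergence of \<open>etime\<close> is non-Zenoness.\<close>

definition all_correct_run :: "('h, 'p) run \<Rightarrow> bool" where
  "all_correct_run R \<longleftrightarrow>
     3 * nfaults R + 1 \<le> nparties R \<and>
     0 \<le> delay R \<and> delay R \<le> max_delay R \<and> 0 < max_delay R \<and>
     etime R 0 = 0 \<and> mono (etime R) \<and> filterlim (etime R) at_top sequentially \<and>
     (\<forall>i \<in> parties R. mono (clock R i) \<and> continuous_on UNIV (clock R i) \<and>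
        (\<forall>s t. gst R \<le> s \<and> s \<le> t \<longrightarrow> clock R i t - clock R i s = t - s)) \<and>
     (\<forall>k. legal_step R k) \<and>
     (\<forall>k i v B. sends R k i (Proposal v B) \<longrightarrow> well_formed R v B) \<and>
     (\<forall>k t. etime R k \<le> t \<and> t < etime R (Suc k) \<longrightarrow>
        (\<forall>i \<in> parties R. \<forall>e. \<not> positive R (Suc k) i e \<and>
           (started R (Suc k) i \<longrightarrow> \<not> timeout R (Suc k) t i e))) \<and>
     (\<forall>s i j m. i \<in> parties R \<and> j \<in> parties R \<and> i \<noteq> j \<and> sends R s i m \<longrightarrow>
        (\<exists>d>s. event R d = Deliver s j \<and> etime R d \<le> max (etime R s) (gst R) + delay R))"


section \<open>Notions of the statement\<close>

definition concerns :: "view \<Rightarrow> ('h, 'p) msg \<Rightarrow> bool" where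
  "concerns v m \<longleftrightarrow> (\<exists>B. m = Proposal v B) \<or> is_echo_response v m \<or> is_ready_response v m \<or>
     wish_of m = Some v"

definition pacemaker_cutoff :: "('h, 'p) run \<Rightarrow> view \<Rightarrow> bool" where
  "pacemaker_cutoff R V \<longleftrightarrow>
     (\<forall>k. etime R k < gst R \<longrightarrow> (\<forall>i \<in> parties R. \<forall>v.
        enters R k i v \<or> (\<exists>m. sends R k i m \<and> concerns v m) \<longrightarrow> v < V)) \<and>
     (\<forall>v \<ge> V. \<forall>s. (\<exists>i \<in> parties R. enters R s i v) \<and> (\<forall>s'<s. \<forall>i \<in> parties R. \<not> enters R s' i v) \<longrightarrow>
        (\<forall>j \<in> parties R. \<exists>s'. enters R s' j v \<and> etime R s' \<le> etime R s + delay R))"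

definition proposal_step :: "('h, 'p) run \<Rightarrow> view \<Rightarrow> nat \<Rightarrow> 'h proposal \<Rightarrow> bool" where
  "proposal_step R u k B \<longleftrightarrow> sends R k (proposer R u) (Proposal u B)"

text \<open>The proposal of view \<open>u\<close> and the time it is sent.\<close>

definition proposal :: "('h, 'p) run \<Rightarrow> view \<Rightarrow> 'h proposal" where
  "proposal R u = (THE B. \<exists>k. proposal_step R u k B)"

definition send_time :: "('h, 'p) run \<Rightarrow> view \<Rightarrow> real" where
  "send_time R u = etime R (THE k. \<exists>B. proposal_step R u k B)"

definition least_unproposed :: "('h, 'p) run \<Rightarrow> real \<Rightarrow> view" where
  "least_unproposed R t = (LEAST w. 1 \<le> w \<and> \<not> (\<exists>k B. proposal_step R w k B \<and> etime R k \<le> t))"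

definition latest_send :: "('h, 'p) run \<Rightarrow> real \<Rightarrow> real" where
  "latest_send R t = Max {etime R k | k. etime R k \<le> t \<and> (\<exists>u \<ge> 1. \<exists>B. proposal_step R u k B)}"

definition prefix_extending :: "('h, 'p) run \<Rightarrow> view \<Rightarrow> bool" where
  "prefix_extending R v \<longleftrightarrow> (\<forall>u. 1 \<le> u \<and> u < v \<longrightarrow> send_time R u \<le> send_time R v)"

definition checks_pass_by :: "('h, 'p) run \<Rightarrow> party \<Rightarrow> 'h manifest \<Rightarrow> 'h manifest \<Rightarrow> real \<Rightarrow> bool" where
  "checks_pass_by R i C T t \<longleftrightarrow>
     (\<exists>k. etime R k \<le> t \<and> core_ok R (Suc k) i C \<and> tip_ok R (Suc k) i C T)"

definition occurs_by :: "('h, 'p) run \<Rightarrow> ('h, 'p) event \<Rightarrow> real \<Rightarrow> bool" where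
  "occurs_by R e t \<longleftrightarrow> (\<exists>k. event R k = e \<and> etime R k \<le> t)"

end

theory Submission
  imports Defs
begin

text \<open>Delays are bounded, so within the delay of the latest send every lower proposal has arrived
  everywhere and the responsive frontier alone makes the next proposer send; this needs no liveness
  of the pacemaker. For a prefix-extending view the same frontier argument activates the view at
  every party by \<open>\<beta> + \<delta>\<close>, when the checks pass, and it remains to exclude timeouts. The proposer
  of a view past the cutoff sends within \<open>\<delta>\<close> of the first entry, so the deadlines counted from
  entry come too late. Only an ECHO window of length \<open>\<Delta>\<close> counted from the receipt can close in
  time, and only at \<open>\<beta> + \<delta>\<close> itself, where the pending positive rules go first. Hence all ECHOs
  have grade 1, so that all READYs do too, and each further round of messages costs one \<open>\<delta>\<close>.\<close>

section \<open>Inversion of the protocol rules\<close>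

inductive_cases positive_bcastE: "positive_rule R k i (Bcast j m)"
inductive_cases positive_enterE: "positive_rule R k i (Enter j v)"
inductive_cases positive_activateE: "positive_rule R k i (Activate j v)"
inductive_cases positive_deliverE: "positive_rule R k i (Deliver s j)"
inductive_cases optional_bcastE: "optional_step R k i (Bcast j m)"
inductive_cases timeout_bcastE: "timeout R k t i (Bcast j m)"

text \<open>Serves to discard the timeout case in legality arguments about events that are not
  responses, such as entries, activations, deliveries and proposals.\<close>

lemma timeout_is_response:
  assumes "timeout R k t i e"
  shows "\<exists>v m. e = Bcast i m \<and> (is_echo_response v m \<or> is_ready_response v m)"
  using assms by cases (auto simp: is_echo_response_def is_ready_response_def)

text \<open>The mix READY behind a refinement is kept, since it lets an induction over steps rule
  refinements out.\<close>

lemma optional_step_cases: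
  assumes "optional_step R k i e"
  shows "(\<exists>b. e = Bcast i (Publish b)) \<or> (\<exists>b. e = Obtain i b) \<or>
    (\<exists>v g B w w'. e = Bcast i (Ready v (Homogeneous g) B w) \<and> sent R k i (Ready v Mix B w'))"
  using assms by cases auto

section \<open>Persistence of the local state and of the checks\<close>

lemma received_mono: "received R k i j m \<Longrightarrow> k \<le> l \<Longrightarrow> received R l i j m"
  unfolding received_def by (meson less_le_trans)

lemma entered_mono: "entered R k i v \<Longrightarrow> k \<le> l \<Longrightarrow> entered R l i v"
  unfolding entered_def by (meson less_le_trans)

lemma activated_mono: "activated R k i m \<Longrightarrow> k \<le> l \<Longrightarrow> activated R l i m"
  unfolding activated_def by (meson less_le_trans)

lemma holds_mono: "holds R k i b \<Longrightarrow> k \<le> l \<Longrightarrow> holds R l i b"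
  unfolding holds_def by (meson less_le_trans received_mono)

lemma direct_pub_mono: "direct_pub R k i r \<Longrightarrow> k \<le> l \<Longrightarrow> direct_pub R l i r"
  unfolding direct_pub_def by (meson holds_mono received_mono)

lemma acknowledged_mono: "acknowledged R k i j r \<Longrightarrow> k \<le> l \<Longrightarrow> acknowledged R l i j r"
  unfolding acknowledged_def by (meson received_mono)

lemma finite_parties [simp]: "finite (parties R)"
  by (simp add: parties_def)

lemma card_parties [simp]: "card (parties R) = nparties R"
  by (simp add: parties_def)

lemma author_ok_mono:
  assumes "author_ok R k i r" "k \<le> l"
  shows "author_ok R l i r"
proof -
  have "card {j \<in> parties R. acknowledged R k i j r} \<le> card {j \<in> parties R. acknowledged R l i j r}"
    by (rule card_mono) (auto intro: acknowledged_mono assms)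
  then show ?thesis
    using assms unfolding author_ok_def by (meson direct_pub_mono le_trans)
qed

lemma core_ok_mono: "core_ok R k i C \<Longrightarrow> k \<le> l \<Longrightarrow> core_ok R l i C"
  unfolding core_ok_def manifest_author_ok_def by (meson author_ok_mono)

lemma tip_ok_mono: "tip_ok R k i C T \<Longrightarrow> k \<le> l \<Longrightarrow> tip_ok R l i C T"
  unfolding tip_ok_def manifest_author_ok_def tip_anchored_def
  by (meson author_ok_mono holds_mono)

section \<open>Pulling the local state back over steps without input\<close>

lemma received_bounded:
  "k \<le> l \<Longrightarrow> received R l i j m \<Longrightarrow> (\<And>s. k \<le> s \<Longrightarrow> s < l \<Longrightarrow> \<not> receives R s i j m)
    \<Longrightarrow> received R k i j m"
  unfolding received_def by (meson not_le)

text \<open>A block is gained by \<open>Obtain\<close>, by a delivery, or by publishing it oneself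
  with immediate self-delivery; \<open>input\<close> covers all three.\<close>

lemma holds_without_input:
  assumes "holds R l i b" "k \<le> l" and quiet: "\<And>s. k \<le> s \<Longrightarrow> s < l \<Longrightarrow> \<not> input i (event R s)"
  shows "holds R k i b"
proof -
  have "\<not> receives R s i j (Publish b)" if "k \<le> s" "s < l" for s j
    using quiet[OF that] by (auto simp: receives_def sends_def input_def)
  moreover have "event R s \<noteq> Obtain i b" if "k \<le> s" "s < l" for s
    using quiet[OF that] by (auto simp: input_def)
  ultimately show ?thesis
    using assms(1,2) unfolding holds_def by (meson not_le received_bounded)
qed

lemma direct_pub_without_input:
  assumes "direct_pub R l i r" "k \<le> l"
    and quiet: "\<And>s. k \<le> s \<Longrightarrow> s < l \<Longrightarrow> \<not> input i (event R s)"
  shows "direct_pub R k i r"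
proof -
  have "\<not> receives R s i j (Publish b)" if "k \<le> s" "s < l" for s j b
    using quiet[OF that] by (auto simp: receives_def sends_def input_def)
  then have "received R k i j (Publish b)" if "received R l i j (Publish b)" for j b
    using that \<open>k \<le> l\<close> by (meson received_bounded)
  moreover have "holds R k i b" if "holds R l i b" for b
    using holds_without_input that \<open>k \<le> l\<close> quiet by blast
  ultimately show ?thesis
    using assms(1) unfolding direct_pub_def by blast
qed

section \<open>The frontier as a maximum over a finite set\<close>

lemma finite_entered: "finite {v. entered R k i v}"
proof -
  have "{v. entered R k i v} \<subseteq> (\<Union>s<k. {v. enters R s i v})"
    by (auto simp: entered_def)
  \<comment> \<open>A step enters at most one view; the inserted 1 accounts for
    \<open>Genesis\<close>.\<close>
  moreover have "finite {v. enters R s i v}" for s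
    by (rule finite_subset[of _ "insert 1 (case event R s of Enter j v \<Rightarrow> {v} | _ \<Rightarrow> {})"])
      (auto simp: enters_def split: event.splits)
  ultimately show ?thesis
    by (meson finite_UN finite_lessThan finite_subset)
qed

lemma finite_activated: "finite {v. activated R k i v}"
proof -
  have "{v. activated R k i v} \<subseteq> (\<Union>s<k. {v. event R s = Activate i v})"
    by (auto simp: activated_def)
  moreover have "finite {v. event R s = Activate i v}" for s
    by (rule finite_subset[of _ "case event R s of Activate j v \<Rightarrow> {v} | _ \<Rightarrow> {}"])
      (auto split: event.splits)
  ultimately show ?thesis
    by (meson finite_UN finite_lessThan finite_subset)
qed

lemma finite_frontier_set:
  "finite ({0} \<union> {v - 1 | v. entered R k i v} \<union> {v. activated R k i v})"
proof -
  have "{v - 1 | v. entered R k i v} = (\<lambda>v. v - 1) ` {v. entered R k i v}"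
    by auto
  then show ?thesis
    using finite_entered[of R k i] finite_activated[of R k i] by (simp del: One_nat_def)
qed

lemma frontier_ge_entered: "entered R k i v \<Longrightarrow> v - 1 \<le> frontier R k i"
  unfolding frontier_def by (rule Max_ge[OF finite_frontier_set]) auto

lemma frontier_cases:
  obtains "frontier R k i = 0"
  | v where "entered R k i v" "frontier R k i = v - 1"
  | "activated R k i (frontier R k i)"
proof -
  have "frontier R k i \<in> {0} \<union> {v - 1 | v. entered R k i v} \<union> {v. activated R k i v}"
    unfolding frontier_def by (rule Max_in[OF finite_frontier_set]) auto
  then show ?thesis using that by blast
qed

section \<open>Timing and quiescent states of a run\<close>

locale correct_run =
  fixes R :: "('h, 'p) run"
  assumes run: "all_correct_run R"
begin

lemma
  shows resilience: "3 * nfaults R + 1 \<le> nparties R"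
    and delay_nonneg: "0 \<le> delay R" and delay_le: "delay R \<le> max_delay R"
    and max_delay_pos: "0 < max_delay R"
    and etime_0: "etime R 0 = 0" and mono_etime: "mono (etime R)"
    and etime_diverges: "filterlim (etime R) at_top sequentially"
    and legal: "legal_step R k"
    and proposals_well_formed: "sends R k i (Proposal v B) \<Longrightarrow> well_formed R v B"
  using run unfolding all_correct_run_def by blast+

lemma clock_diff:
  "i \<in> parties R \<Longrightarrow> gst R \<le> s \<Longrightarrow> gst R \<le> t \<Longrightarrow> clock R i t - clock R i s = t - s"
proof -
  assume a: "i \<in> parties R" "gst R \<le> s" "gst R \<le> t"
  have *: "\<forall>s t. gst R \<le> s \<and> s \<le> t \<longrightarrow> clock R i t - clock R i s = t - s"
    using run a(1) unfolding all_correct_run_def by blast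
  show ?thesis
  proof (cases "s \<le> t")
    case True
    then show ?thesis using * a by blast
  next
    case False
    then have "clock R i s - clock R i t = s - t" using * a by simp
    then show ?thesis by simp
  qed
qed

lemma delivered:
  "i \<in> parties R \<Longrightarrow> j \<in> parties R \<Longrightarrow> i \<noteq> j \<Longrightarrow> sends R s i m \<Longrightarrow>
    \<exists>d. event R d = Deliver s j \<and> etime R d \<le> max (etime R s) (gst R) + delay R"
  using run unfolding all_correct_run_def by blast

lemma etime_mono: "k \<le> l \<Longrightarrow> etime R k \<le> etime R l"
  using mono_etime by (simp add: monoD)

lemma etime_nonneg: "0 \<le> etime R k"
  using etime_mono[of 0 k] etime_0 by simp

lemma proposer_in_parties: "proposer R v \<in> parties R"
proof -
  have "(v - 1) mod nparties R < nparties R" using resilience by simp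
  then show ?thesis by (simp add: proposer_def parties_def)
qed

lemma quorum_le: "quorum R \<le> nparties R" and quorum_pos: "0 < quorum R"
  using resilience by (auto simp: quorum_def)

text \<open>As times diverge, there is a first step later than \<open>t\<close>. The time
  \<open>t\<close> lies in the gap before it, where the run leaves no positive rule enabled. Hence
  whatever a positive rule demands on the basis of the events up to \<open>t\<close> has itself
  happened by \<open>t\<close>; every upper time bound on a protocol action below is obtained this
  way.\<close>

lemma quiescent:
  assumes "0 \<le> t"
  obtains K where "\<And>s. s < K \<longleftrightarrow> etime R s \<le> t"
    and "\<And>i e. i \<in> parties R \<Longrightarrow> \<not> positive_rule R K i e"
proof -
  have ex: "\<exists>k. t < etime R k"
    using etime_diverges unfolding filterlim_at_top_dense
    by (meson eventually_sequentially order_refl)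
  define K where "K = (LEAST k. t < etime R k)"
  have K: "t < etime R K" unfolding K_def using ex by (rule LeastI_ex)
  have less: "etime R s \<le> t" if "s < K" for s
    using not_less_Least[OF that[unfolded K_def]] by simp
  \<comment> \<open>Step 0 happens at time 0 \<le> \<open>t\<close>, so the cut has a predecessor
    \<open>L\<close>, and the gap condition applies between \<open>L\<close> and
    \<open>Suc L\<close>.\<close>
  have "K \<noteq> 0"
    using K assms etime_0 by (metis not_less)
  then obtain L where L: "K = Suc L" by (cases K) auto
  have "etime R L \<le> t \<and> t < etime R (Suc L)"
    using K less L by auto
  then have quiet: "\<forall>i \<in> parties R. \<forall>e. \<not> positive R (Suc L) i e"
    using run unfolding all_correct_run_def by blast
  \<comment> \<open>For a party not yet started, \<open>Genesis\<close> itself would be an enabled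
    positive event.\<close>
  have st: "started R K i" if "i \<in> parties R" for i
    using quiet that L unfolding positive_def by metis
  show ?thesis
  proof
    show "s < K \<longleftrightarrow> etime R s \<le> t" for s
      using less K etime_mono by (meson not_le order_trans)
    show "\<not> positive_rule R K i e" if "i \<in> parties R" for i e
      using quiet st that L unfolding positive_def by metis
  qed
qed

section \<open>Causality of broadcasts and deliveries\<close>

lemma bcast_legal:
  assumes "event R k = Bcast i m"
  shows "i \<in> parties R" "started R k i"
    and "positive_rule R k i (Bcast i m) \<or> timeout_step R k i \<or> optional_step R k i (Bcast i m)"
proof -
  obtain j where j: "j \<in> parties R" and c: "positive R k j (Bcast i m) \<or>
     (started R k j \<and> (timeout_step R k j \<or> optional_step R k j (Bcast i m) \<or> delivery R k j (Bcast i m)))"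
    using legal[of k] assms unfolding legal_step_def by auto
  have nd: "\<not> delivery R k j (Bcast i m)" by (simp add: delivery_def)
  have "started R k j" using c unfolding positive_def by (auto split: if_splits)
  have c': "positive_rule R k j (Bcast i m) \<or> timeout_step R k j \<or> optional_step R k j (Bcast i m)"
    using c nd unfolding positive_def by (auto split: if_splits)
  \<comment> \<open>Legality names only some acting party \<open>j\<close>, but every rule
    broadcasts in the name of the party that takes it.\<close>
  then have "j = i"
    by (elim disjE)
      (auto elim: positive_bcastE optional_bcastE simp: timeout_step_def assms dest: timeout_is_response)
  then show "i \<in> parties R" "started R k i"
    "positive_rule R k i (Bcast i m) \<or> timeout_step R k i \<or> optional_step R k i (Bcast i m)"
    using j \<open>started R k j\<close> c' by auto
qed

lemma deliver_legal:
  assumes "event R k = Deliver s i"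
  shows "s < k"
  using legal[of k] assms unfolding legal_step_def
  by (auto simp: positive_def delivery_def timeout_step_def
      elim: positive_deliverE dest: timeout_is_response optional_step_cases split: if_splits)

lemma received_imp_sent: "received R k i j m \<Longrightarrow> sent R k j m"
  unfolding received_def receives_def sent_def
  by (metis deliver_legal dual_order.strict_trans)

text \<open>The premise on \<open>k\<close> has the shape that \<open>quiescent\<close> provides:
  the cut lies behind the delivery bound. Self-delivery fits the same premise because \<delta> \<ge>
  0.\<close>

lemma sent_imp_received:
  assumes "i \<in> parties R" "j \<in> parties R" "sends R s j m"
    and "\<And>d. etime R d \<le> max (etime R s) (gst R) + delay R \<Longrightarrow> d < k"
  shows "received R k i j m"
proof (cases "i = j")
  case True
  have "etime R s \<le> max (etime R s) (gst R) + delay R" using delay_nonneg by simp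
  then show ?thesis
    using assms True unfolding received_def receives_def by blast
next
  case False
  then show ?thesis
    using delivered[of j i s m] assms unfolding received_def receives_def by metis
qed

text \<open>Proposals are sent by the \<open>propose\<close> rule alone, whose guard gives all three
  facts.\<close>

lemma proposal_sent:
  assumes "sends R k i (Proposal v B)"
  shows "1 \<le> v" "i = proposer R v" "\<not> sent R k i (Proposal v B')"
proof -
  have ev: "event R k = Bcast i (Proposal v B)"
    using assms by (auto simp: sends_def)
  have "positive_rule R k i (Bcast i (Proposal v B))"
    using bcast_legal(3)[OF ev]
    by (auto simp: timeout_step_def ev is_echo_response_def is_ready_response_def
        dest!: timeout_is_response optional_step_cases)
  then show "1 \<le> v" "i = proposer R v" "\<not> sent R k i (Proposal v B')"
    by (cases, blast)+
qed

lemma proposal_unique: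
  assumes "proposal_step R v k B" "proposal_step R v l B'"
  shows "k = l \<and> B = B'"
proof -
  have "k = l"
    using assms proposal_sent(3) unfolding proposal_step_def sent_def
    by (metis linorder_neqE_nat)
  then show ?thesis
    using assms by (auto simp: proposal_step_def sends_def)
qed

section \<open>Views are entered and activated in order\<close>

lemma enter_lower:
  assumes "entered R k i v" "1 \<le> u" "u \<le> v"
  shows "entered R k i u"
proof -
  obtain s where s: "s < k" "enters R s i v"
    using assms(1) by (auto simp: entered_def)
  show ?thesis
  proof (cases "event R s = Enter i v")
    case True
    then have "positive_rule R s i (Enter i v)"
      using legal[of s] unfolding legal_step_def
      by (auto simp: positive_def delivery_def timeout_step_def
          elim: positive_enterE dest: timeout_is_response optional_step_cases split: if_splits)
    then have "u < v \<longrightarrow> entered R s i u"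
      using assms(2) by (auto elim: positive_enterE)
    then show ?thesis
      using assms s entered_mono by (metis le_neq_implies_less less_imp_le)
  next
    case False
    then have "v = 1" using s by (auto simp: enters_def)
    then show ?thesis using assms by auto
  qed
qed

text \<open>The frontier skips no view. If an entry attains it, all lower views have been entered
  too; if an activation attains it, that activation raised it by exactly one, and the induction
  continues in the state before.\<close>

lemma frontier_activated_or_entered:
  "1 \<le> u \<Longrightarrow> u \<le> frontier R k i \<Longrightarrow> activated R k i u \<or> entered R k i u"
proof (induction k arbitrary: u rule: less_induct)
  case (less k)
  show ?case
  proof (cases rule: frontier_cases[of R k i])
    case 1
    then show ?thesis using less.prems by simp
  next
    case (2 v)
    then show ?thesis using enter_lower[of k i v u] less.prems by simp
  next
    case 3
    then obtain s where s: "s < k" "event R s = Activate i (frontier R k i)"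
      by (auto simp: activated_def)
    then have "positive_rule R s i (Activate i (frontier R k i))"
      using legal[of s] unfolding legal_step_def
      by (auto simp: positive_def delivery_def timeout_step_def
          elim: positive_activateE dest: timeout_is_response optional_step_cases split: if_splits)
    then have "frontier R k i = frontier R s i + 1"
      by (auto elim: positive_activateE)
    then consider "u \<le> frontier R s i" | "u = frontier R k i"
      using less.prems by linarith
    then show ?thesis
    proof cases
      case 1
      then show ?thesis
        using less.IH[OF s(1) less.prems(1)] s(1) activated_mono entered_mono by (meson less_imp_le)
    next
      case 2
      then show ?thesis using 3 by simp
    qed
  qed
qed

text \<open>Fixing concerns the first proposal received; since a view has only one proposal, the
  first one received is already \<open>B\<close>.\<close>

lemma fixed_if_received:
  assumes "received R k i (proposer R v) (Proposal v B)"
  shows "fixed_proposal R k i v B"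
proof -
  let ?P = "\<lambda>s. \<exists>B'. receives R s i (proposer R v) (Proposal v B')"
  obtain s where s: "s < k" "?P s"
    using assms unfolding received_def by blast
  define l where "l = (LEAST s. ?P s)"
  have "?P l" unfolding l_def using s(2) by (rule LeastI)
  then obtain B' where B': "receives R l i (proposer R v) (Proposal v B')" ..
  have "l \<le> s" unfolding l_def using s(2) by (rule Least_le)
  have "received R (Suc l) i (proposer R v) (Proposal v B')"
    using B' by (auto simp: received_def)
  then have "B' = B"
    using assms proposal_unique[of v] received_imp_sent unfolding proposal_step_def sent_def by blast
  moreover have "\<not> ?P s'" if "s' < l" for s'
    using that unfolding l_def by (rule not_less_Least)
  ultimately show ?thesis
    using B' \<open>l \<le> s\<close> s(1) unfolding fixed_proposal_def fixes_proposal_def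
    by (metis le_less_trans)
qed

text \<open>If the frontier stopped below \<open>v\<close>, the proposal of the view just above it
  would be received, hence fixed and well formed, and \<open>activate\<close> would be
  enabled.\<close>

lemma active_when_prefix_received:
  assumes quiet: "\<And>e. \<not> positive_rule R k i e"
    and rec: "\<And>u. 1 \<le> u \<Longrightarrow> u \<le> v \<Longrightarrow> \<exists>B. received R k i (proposer R u) (Proposal u B)"
  shows "v \<le> frontier R k i"
    and "1 \<le> v \<Longrightarrow> received R k i (proposer R v) (Proposal v B) \<Longrightarrow> active_proposal R k i v B"
proof -
  have wf: "well_formed R u B" if "received R k i (proposer R u) (Proposal u B)" for u B
    using received_imp_sent[OF that] proposals_well_formed unfolding sent_def by blast
  show le: "v \<le> frontier R k i"
  proof (rule ccontr)
    assume "\<not> v \<le> frontier R k i"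
    then have "\<exists>B. received R k i (proposer R (frontier R k i + 1)) (Proposal (frontier R k i + 1) B)"
      by (intro rec) simp_all
    then obtain B where "received R k i (proposer R (frontier R k i + 1)) (Proposal (frontier R k i + 1) B)" ..
    note B = this
    have "positive_rule R k i (Activate i (frontier R k i + 1))"
      by (rule positive_rule.activate[OF refl fixed_if_received[OF B] wf[OF B]])
    then show False using quiet by simp
  qed
  assume "1 \<le> v" "received R k i (proposer R v) (Proposal v B)"
  then show "active_proposal R k i v B"
    using frontier_activated_or_entered le fixed_if_received wf unfolding active_proposal_def by blast
qed

section \<open>Each proposal follows the lower ones\<close>

lemma proposal_sent_at_frontier:
  assumes "\<And>e. \<not> positive_rule R k (proposer R v) e" "1 \<le> v" "v - 1 \<le> frontier R k (proposer R v)"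
  shows "\<exists>s B. s < k \<and> proposal_step R v s B"
proof -
  have "\<exists>B. sent R k (proposer R v) (Proposal v B)"
    using assms(1) positive_rule.propose[OF assms(2) refl _ disjI1[OF assms(3)]] by blast
  then show ?thesis by (auto simp: sent_def proposal_step_def)
qed

text \<open>Every lower proposal reaches the proposer by \<open>t\<close> + \<delta>, so its
  frontier is at least \<open>v - 1\<close> in the quiescent state at that time. An explicit time
  \<open>t\<close> replaces \<open>send_time\<close> here, because the existence of proposals, which
  gives \<open>send_time\<close> its meaning, is derived from this lemma.\<close>

lemma next_proposal:
  assumes "0 \<le> t" "gst R \<le> t"
    and "\<And>u. 1 \<le> u \<Longrightarrow> u < v \<Longrightarrow> \<exists>k B. proposal_step R u k B \<and> etime R k \<le> t" and "1 \<le> v"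
  shows "\<exists>k B. proposal_step R v k B \<and> etime R k \<le> t + delay R"
proof -
  have "0 \<le> t + delay R" using assms(1) delay_nonneg by simp
  then obtain K where K: "\<And>s. s < K \<longleftrightarrow> etime R s \<le> t + delay R"
    and quiet: "\<And>i e. i \<in> parties R \<Longrightarrow> \<not> positive_rule R K i e"
    by (rule quiescent) (rule that)
  have rec: "\<exists>B. received R K i (proposer R u) (Proposal u B)" if u: "1 \<le> u" "u \<le> v - 1" and i: "i \<in> parties R" for i u
  proof -
    have "u < v" using u assms(4) by linarith
    then obtain k B where k: "proposal_step R u k B" "etime R k \<le> t"
      using assms(3)[OF u(1)] by blast
    have sends: "sends R k (proposer R u) (Proposal u B)"
      using k(1) by (simp add: proposal_step_def)
    have "max (etime R k) (gst R) \<le> t"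
      using k(2) assms(2) by simp
    then have "received R K i (proposer R u) (Proposal u B)"
      by (intro sent_imp_received[OF i proposer_in_parties sends]) (auto simp: K)
    then show ?thesis ..
  qed
  have "v - 1 \<le> frontier R K (proposer R v)"
    by (rule active_when_prefix_received(1)) (use quiet rec proposer_in_parties in auto)
  then show ?thesis
    using proposal_sent_at_frontier[OF quiet[OF proposer_in_parties] assms(4)] K by blast
qed

lemma proposal_exists: "1 \<le> v \<Longrightarrow> \<exists>k B. proposal_step R v k B"
proof (induction v rule: less_induct)
  case (less v)
  have "\<forall>u. \<exists>k. u \<in> {1..<v} \<longrightarrow> (\<exists>B. proposal_step R u k B)"
    using less.IH by (simp del: split_paired_Ex)
  then have "\<exists>s. \<forall>u. u \<in> {1..<v} \<longrightarrow> (\<exists>B. proposal_step R u (s u) B)"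
    by (rule choice)
  then obtain s where s: "\<And>u. u \<in> {1..<v} \<Longrightarrow> \<exists>B. proposal_step R u (s u) B"
    by blast
  \<comment> \<open>The lower send times together with 0 and the GST, so that the premises of
    \<open>next_proposal\<close> hold; the choice function \<open>s\<close> makes this a maximum
    over a finite set.\<close>
  define t where "t = Max (insert 0 (insert (gst R) ((\<lambda>u. etime R (s u)) ` {1..<v})))"
  have "x \<le> t" if "x \<in> insert 0 (insert (gst R) ((\<lambda>u. etime R (s u)) ` {1..<v}))" for x
    unfolding t_def using that by (intro Max_ge) auto
  then have t: "0 \<le> t" "gst R \<le> t" "\<And>u. u \<in> {1..<v} \<Longrightarrow> etime R (s u) \<le> t"
    by blast+
  have "\<exists>k B. proposal_step R v k B \<and> etime R k \<le> t + delay R"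
  proof (rule next_proposal[OF t(1,2) _ less.prems])
    fix u assume "1 \<le> u" "u < v"
    then have "u \<in> {1..<v}" by simp
    then show "\<exists>k B. proposal_step R u k B \<and> etime R k \<le> t"
      using s[of u] t(3)[of u] by blast
  qed
  then show ?case by blast
qed

section \<open>Proposals and send times are well defined\<close>

lemma proposal_ex1:
  assumes "1 \<le> u"
  shows "\<exists>!(k, B). proposal_step R u k B"
proof -
  obtain k B where kB: "proposal_step R u k B" using proposal_exists[OF assms] by blast
  show ?thesis
  proof (rule ex1I[of _ "(k, B)"])
    fix x assume "case x of (l, B') \<Rightarrow> proposal_step R u l B'"
    then have "proposal_step R u (fst x) (snd x)" by (simp add: case_prod_beta)
    then show "x = (k, B)" using proposal_unique[OF kB] by (simp add: prod_eq_iff)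
  qed (simp add: kB)
qed

lemma send_time_eq: "proposal_step R u k B \<Longrightarrow> send_time R u = etime R k"
  unfolding send_time_def using proposal_unique[of u] by (intro arg_cong[of _ _ "etime R"] the_equality) blast+

lemma proposal_eq: "proposal_step R u k B \<Longrightarrow> proposal R u = B"
  unfolding proposal_def using proposal_unique[of u] by (intro the_equality) blast+

lemma send_timeE:
  assumes "1 \<le> u"
  obtains k where "proposal_step R u k (proposal R u)" "etime R k = send_time R u"
proof -
  obtain k B where "proposal_step R u k B" using proposal_exists[OF assms] by blast
  then show ?thesis using that[of k] proposal_eq[of u k B] send_time_eq[of u k B] by simp
qed

lemma next_send_time:
  assumes "gst R \<le> t" "0 \<le> t" "\<And>u. 1 \<le> u \<Longrightarrow> u \<le> v \<Longrightarrow> send_time R u \<le> t"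
  shows "send_time R (v + 1) \<le> t + delay R"
proof -
  have "\<exists>k B. proposal_step R (v + 1) k B \<and> etime R k \<le> t + delay R"
  proof (rule next_proposal[OF assms(2,1)])
    fix u assume u: "1 \<le> u" "u < v + 1"
    obtain k where k: "proposal_step R u k (proposal R u)" "etime R k = send_time R u"
      using send_timeE[OF u(1)] .
    have "etime R k \<le> t"
      using k(2) assms(3)[of u] u by simp
    with k(1) show "\<exists>k B. proposal_step R u k B \<and> etime R k \<le> t"
      by blast
  qed simp
  then show ?thesis
    using send_time_eq by force
qed

section \<open>Echo-stage responses\<close>

lemma echo_response_cases:
  assumes "sends R k i m" "is_echo_response v m"
  obtains "positive_rule R k i (Bcast i m)" "\<not> echo_done R k i v"
  | "timeout R k (etime R k) i (Bcast i m)" "timeout_step R k i" "\<not> echo_done R k i v"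
proof -
  have ev: "event R k = Bcast i m"
    using assms by (auto simp: sends_def is_echo_response_def)
  have "positive_rule R k i (Bcast i m) \<or> timeout_step R k i"
    using bcast_legal(3)[OF ev] assms(2)
    by (auto simp: is_echo_response_def dest: optional_step_cases)
  then show ?thesis
  proof
    assume p: "positive_rule R k i (Bcast i m)"
    then have "\<not> echo_done R k i v"
      by cases (use assms(2) in \<open>auto simp: is_echo_response_def\<close>)
    then show ?thesis using that(1) p by blast
  next
    assume t: "timeout_step R k i"
    then have t': "timeout R k (etime R k) i (Bcast i m)"
      by (simp add: timeout_step_def ev)
    then have "\<not> echo_done R k i v"
      by cases (use assms(2) in \<open>auto simp: is_echo_response_def split: if_splits\<close>)
    then show ?thesis using that(2) t t' by blast
  qed
qed

text \<open>Of two responses in different steps, the later one would violate the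
  \<open>echo_done\<close> guard shared by all rules that send them.\<close>

lemma echo_response_unique:
  assumes "sends R k i m" "is_echo_response v m" "sends R l i m'" "is_echo_response v m'"
  shows "m = m'"
proof -
  have "k = l"
  proof (rule ccontr)
    assume "k \<noteq> l"
    then have "echo_done R k i v \<or> echo_done R l i v"
      using assms unfolding echo_done_def sent_def by (metis linorder_neqE_nat)
    then show False
      using assms by (auto elim: echo_response_cases)
  qed
  then show ?thesis
    using assms by (auto simp: sends_def is_echo_response_def)
qed

section \<open>The checks become true only through input\<close>

lemma echo_acks:
  assumes "sends R k i (Echo v g B A w)"
  shows "A = acks R k i B"
  by (rule echo_response_cases[OF assms])
    (auto simp: is_echo_response_def elim: positive_bcastE timeout_bcastE split: if_splits)

lemma author_ok_without_input:
  assumes "author_ok R l i r" "k \<le> l"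
    and quiet: "\<And>s. k \<le> s \<Longrightarrow> s < l \<Longrightarrow> \<not> input i (event R s)"
  shows "author_ok R k i r"
proof (cases "direct_pub R k i r")
  case True
  then show ?thesis by (simp add: author_ok_def)
next
  case False
  \<comment> \<open>A new acknowledgment could only be an own one, which requires \<open>direct_pub\<close>.\<close>
  have "acknowledged R k i j r" if ack: "acknowledged R l i j r" for j
  proof (rule ccontr)
    assume na: "\<not> acknowledged R k i j r"
    obtain v g B A w s where s: "s < l" "receives R s i j (Echo v g B A w)" "r \<in> A"
      using ack unfolding acknowledged_def received_def by blast
    then have "k \<le> s"
      using na unfolding acknowledged_def received_def by (meson not_le)
    then have "sends R s i (Echo v g B A w)"
      using s quiet[of s] by (auto simp: receives_def input_def)
    then have "direct_pub R s i r"
      using echo_acks[of s i v g B A w] s(3) by (auto simp: acks_def)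
    then have "direct_pub R k i r"
      using direct_pub_without_input[of R s i r k] \<open>k \<le> s\<close> s(1) quiet by fastforce
    then show False using False by simp
  qed
  then have "{j \<in> parties R. acknowledged R l i j r} \<subseteq> {j \<in> parties R. acknowledged R k i j r}"
    by auto
  then have "card {j \<in> parties R. acknowledged R l i j r} \<le> card {j \<in> parties R. acknowledged R k i j r}"
    by (rule card_mono[rotated]) auto
  moreover have "\<not> direct_pub R l i r"
    using False direct_pub_without_input assms by blast
  ultimately show ?thesis
    using assms(1) unfolding author_ok_def by linarith
qed

text \<open>Complements persistence in the backward direction: checks that hold at the end of an
  instant are carried back to a timeout taken within that instant.\<close>

lemma checks_without_input:
  assumes "k \<le> l" and quiet: "\<And>s. k \<le> s \<Longrightarrow> s < l \<Longrightarrow> \<not> input i (event R s)"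
  shows "core_ok R l i C \<Longrightarrow> core_ok R k i C" and "tip_ok R l i C T \<Longrightarrow> tip_ok R k i C T"
proof -
  note a = author_ok_without_input[OF _ assms(1) quiet]
  note h = holds_without_input[OF _ assms(1) quiet]
  show "core_ok R l i C \<Longrightarrow> core_ok R k i C"
    using a unfolding core_ok_def manifest_author_ok_def by blast
  show "tip_ok R l i C T \<Longrightarrow> tip_ok R k i C T"
    using a h unfolding tip_ok_def manifest_author_ok_def tip_anchored_def by meson
qed

section \<open>Timing of entries, sends and timeouts past the cutoff\<close>

lemma gst_le_after_cutoff:
  assumes "pacemaker_cutoff R V" "V \<le> v" "i \<in> parties R"
    and "enters R k i v \<or> (\<exists>m. sends R k i m \<and> concerns v m)"
  shows "gst R \<le> etime R k"
  using assms unfolding pacemaker_cutoff_def by (meson not_le)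

lemma gst_le_send_time:
  assumes "pacemaker_cutoff R V" "V \<le> v" "1 \<le> v"
  shows "gst R \<le> send_time R v"
proof -
  obtain k where k: "proposal_step R v k (proposal R v)" "etime R k = send_time R v"
    using send_timeE[OF assms(3)] .
  then show ?thesis
    using gst_le_after_cutoff[OF assms(1,2) proposer_in_parties] unfolding proposal_step_def concerns_def
    by metis
qed

text \<open>Within \<delta> of the first entry the proposer has entered as well, which alone lifts
  its frontier to \<open>v - 1\<close> and triggers the proposal.\<close>

lemma send_time_after_entry:
  assumes "pacemaker_cutoff R V" "V \<le> v" "1 \<le> v" "i \<in> parties R" "enters R s i v"
  shows "send_time R v \<le> etime R s + delay R"
proof -
  let ?P = "\<lambda>s. \<exists>i \<in> parties R. enters R s i v"
  \<comment> \<open>The cutoff bounds the spread of entries only from the first one; the given entry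
    \<open>s\<close> is no earlier.\<close>
  define l where "l = (LEAST s. ?P s)"
  have "?P s" using assms(4,5) by blast
  then have "?P l" "l \<le> s" unfolding l_def by (rule LeastI, rule Least_le)
  moreover have "\<not> ?P s'" if "s' < l" for s'
    using that unfolding l_def by (rule not_less_Least)
  ultimately have "\<exists>s'. enters R s' (proposer R v) v \<and> etime R s' \<le> etime R l + delay R"
    using assms(1,2) proposer_in_parties unfolding pacemaker_cutoff_def by blast
  then obtain s' where s': "enters R s' (proposer R v) v" "etime R s' \<le> etime R s + delay R"
    using etime_mono[OF \<open>l \<le> s\<close>] by force
  have "0 \<le> etime R s + delay R" using etime_nonneg delay_nonneg by simp
  then obtain K where K: "\<And>x. x < K \<longleftrightarrow> etime R x \<le> etime R s + delay R"
    and quiet: "\<And>i e. i \<in> parties R \<Longrightarrow> \<not> positive_rule R K i e"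
    by (rule quiescent) (rule that)
  have "entered R K (proposer R v) v"
    using s' K by (auto simp: entered_def)
  then have "v - 1 \<le> frontier R K (proposer R v)"
    by (rule frontier_ge_entered)
  then show ?thesis
    using proposal_sent_at_frontier[OF quiet[OF proposer_in_parties] assms(3)] K send_time_eq by fastforce
qed

text \<open>After the GST the clock difference is real elapsed time, and the proposal is sent at
  most \<delta> after the party's own entry. With \<open>c\<close> = 3\<Delta> the timeout comes no
  earlier than \<beta> + 2\<Delta>, hence after \<beta> + \<delta>; with \<open>c\<close> =
  4\<Delta> no earlier than \<beta> + 3\<Delta>, hence after \<beta> + 2\<delta>.\<close>

lemma timeout_after_send:
  assumes "pacemaker_cutoff R V" "V \<le> v" "1 \<le> v" "i \<in> parties R" "entered R k i v"
    and "entry_clock R i v + c \<le> clock R i (etime R k)"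
  shows "send_time R v + c \<le> etime R k + delay R"
proof -
  obtain x where x: "x < k" "enters R x i v"
    using assms(5) by (auto simp: entered_def)
  define l where "l = (LEAST s. enters R s i v)"
  have l: "enters R l i v" "l \<le> x"
    unfolding l_def using x(2) by (rule LeastI, rule Least_le)
  have "gst R \<le> etime R l"
    using gst_le_after_cutoff[OF assms(1,2,4)] l(1) by blast
  moreover have "etime R l \<le> etime R k"
    using etime_mono l(2) x(1) by simp
  ultimately have "clock R i (etime R k) - clock R i (etime R l) = etime R k - etime R l"
    using clock_diff[OF assms(4)] by simp
  then show ?thesis
    using send_time_after_entry[OF assms(1-4) l(1)] assms(6) unfolding entry_clock_def l_def[symmetric]
    by simp
qed

end

section \<open>The ECHO stage of a prefix-extending view\<close>

locale prefix_extending_view = correct_run R for R :: "('h, 'p) run" +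
  fixes V v :: view and C T :: "'h manifest"
  assumes cutoff: "pacemaker_cutoff R V" and past: "1 \<le> v" "V \<le> v"
    and proposal: "proposal R v = (C, T)"
    and prefix: "prefix_extending R v"
    and checks: "\<And>i. i \<in> parties R \<Longrightarrow> checks_pass_by R i C T (send_time R v + delay R)"
begin

lemma gst_le: "gst R \<le> send_time R v"
  using gst_le_send_time cutoff past by blast


lemma send_time_nonneg: "0 \<le> send_time R v"
proof -
  obtain k where "etime R k = send_time R v"
    using send_timeE[OF past(1)] by blast
  then show ?thesis using etime_nonneg[of k] by simp
qed

text \<open>Here \<open>c\<close> counts message delays since the send: 1 for the proposal, 2 for
  the ECHOs, 3 for the READYs.\<close>

lemma quiescent_after:
  assumes "0 \<le> c"
  obtains K where "\<And>s. s < K \<longleftrightarrow> etime R s \<le> send_time R v + c * delay R"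
    and "\<And>i e. i \<in> parties R \<Longrightarrow> \<not> positive_rule R K i e"
proof -
  have "0 \<le> send_time R v + c * delay R"
    using send_time_nonneg delay_nonneg assms by simp
  then show ?thesis by (rule quiescent) (rule that)
qed

lemma proposal_step_eq: "proposal_step R v k B \<Longrightarrow> B = (C, T) \<and> etime R k = send_time R v"
  using proposal_eq[of v k B] send_time_eq[of v k B] proposal by simp

lemma active_proposal_eq: "active_proposal R k i v B \<Longrightarrow> B = (C, T)"
proof -
  assume "active_proposal R k i v B"
  then have "received R k i (proposer R v) (Proposal v B)"
    unfolding active_proposal_def fixed_proposal_def fixes_proposal_def received_def by blast
  then have "\<exists>s. proposal_step R v s B"
    unfolding proposal_step_def using received_imp_sent unfolding sent_def by blast
  then show ?thesis using proposal_step_eq by blast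
qed

lemma prefix_received:
  assumes "i \<in> parties R" "1 \<le> u" "u \<le> v" "\<And>s. s < K \<longleftrightarrow> etime R s \<le> send_time R v + delay R"
  shows "received R K i (proposer R u) (Proposal u (proposal R u))"
proof -
  obtain k where k: "proposal_step R u k (proposal R u)" "etime R k = send_time R u"
    using send_timeE[OF assms(2)] .
  have "send_time R u \<le> send_time R v"
    using prefix assms(2,3) unfolding prefix_extending_def by (cases "u = v") auto
  then show ?thesis
    using k gst_le assms(1,4) proposer_in_parties
    by (intro sent_imp_received[of _ _ k]) (auto simp: proposal_step_def)
qed

lemma checks_at:
  assumes "i \<in> parties R" "\<And>s. s < K \<longleftrightarrow> etime R s \<le> send_time R v + delay R"
  shows "core_ok R K i C" "tip_ok R K i C T"
  using checks[OF assms(1)] assms(2) core_ok_mono tip_ok_mono unfolding checks_pass_by_def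
  by (meson Suc_leI)+

text \<open>Formulated for any state without enabled positive rules, because it is applied both at
  the end of the instant \<beta> + \<delta> and at a timeout step inside that instant.\<close>

lemma echo_enabled:
  assumes quiet: "\<And>e. \<not> positive_rule R k i e"
    and rec: "\<And>u. 1 \<le> u \<Longrightarrow> u \<le> v \<Longrightarrow> received R k i (proposer R u) (Proposal u (proposal R u))"
    and "core_ok R k i C" "tip_ok R k i C T"
  shows "echo_done R k i v"
proof -
  have "active_proposal R k i v (C, T)"
  proof (rule active_when_prefix_received(2)[OF quiet _ past(1)])
    show "\<exists>B. received R k i (proposer R u) (Proposal u B)" if "1 \<le> u" "u \<le> v" for u
      using rec[OF that] ..
    show "received R k i (proposer R v) (Proposal v (C, T))"
      using rec[OF past(1)] proposal by simp
  qed
  then show ?thesis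
    using positive_rule.echo[of v R k i C T] quiet past(1) assms(3,4) by blast
qed

text \<open>Deadlines of 3\<Delta> from entry lie beyond \<beta> + \<delta>, which settles
  \<open>echo_absent\<close> and one branch of the window. What remains is the window counted from
  receipt, and this matters only when \<delta> = \<Delta>.\<close>

lemma no_echo_timeout:
  assumes i: "i \<in> parties R" and "timeout_step R k i" and late: "etime R k \<le> send_time R v + delay R"
    and ev: "event R k = Bcast i m" and m: "timeout R k (etime R k) i (Bcast i m)" "is_echo_response v m"
  shows False
  using m(1)
proof cases
  case (echo_window v' s C' T')
  have v': "v' = v"
    using echo_window(1) m(2) by (cases "core_ok R k i C'") (simp_all add: is_echo_response_def)
  have "entered R k i v" using echo_window(3) v' by simp
  then have "\<not> entry_clock R i v + 3 * max_delay R \<le> clock R i (etime R k)"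
    using timeout_after_send[OF cutoff past(2,1) i, of k "3 * max_delay R"] late
      delay_le max_delay_pos by linarith
  \<comment> \<open>With the entry deadline excluded, the other argument of the \<open>min\<close>
    has passed, and the \<open>max\<close> in it is at least the clock at receipt.\<close>
  then have "clock R i (etime R s) + max_delay R \<le> clock R i (etime R k)"
    using echo_window(8) v' by (simp add: min_le_iff_disj)
  moreover have "send_time R v \<le> etime R s"
  proof -
    have "received R (Suc s) i (proposer R v) (Proposal v (C', T'))"
      using echo_window(6) v' unfolding fixes_proposal_def received_def by blast
    then obtain x where x: "x < Suc s" "proposal_step R v x (C', T')"
      by (auto dest!: received_imp_sent simp: sent_def proposal_step_def)
    have "etime R x \<le> etime R s" using x(1) by (intro etime_mono) simp
    then show ?thesis using proposal_step_eq[OF x(2)] by simp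
  qed
  moreover have "clock R i (etime R k) - clock R i (etime R s) = etime R k - etime R s"
  proof (rule clock_diff[OF i])
    show "gst R \<le> etime R s" using \<open>send_time R v \<le> etime R s\<close> gst_le by simp
    then show "gst R \<le> etime R k" using etime_mono[of s k] \<open>s < k\<close> by simp
  qed
  \<comment> \<open>Receipt is at \<beta> or later, so \<beta> + \<Delta> is at most the present
    time, which is at most \<beta> + \<delta> \<le> \<beta> + \<Delta>. All of these
    coincide.\<close>
  ultimately have now: "etime R k = send_time R v + delay R" "send_time R v < etime R k"
    using late delay_le max_delay_pos by linarith+
  \<comment> \<open>The window closes exactly at the time by which the checks pass. As no input follows at that
    time, they have already passed in state \<open>k\<close>, so the grade-1 ECHO is enabled there.\<close>
  obtain K where K: "\<And>s. s < K \<longleftrightarrow> etime R s \<le> send_time R v + delay R"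
    by (rule quiescent_after[of 1]) (auto intro: that)
  have "k \<le> K" using K[of k] late by simp
  \<comment> \<open>Step \<open>k\<close> broadcasts a response and no block; the later steps before
    \<open>K\<close> have the same time as \<open>k\<close>, where the timeout rule forbids further
    input.\<close>
  have no_input: "\<not> input i (event R s)" if "k \<le> s" "s < K" for s
  proof (cases "s = k")
    case True
    then show ?thesis
      using ev m(2) by (auto simp: input_def is_echo_response_def)
  next
    case False
    then have "k < s" "etime R s = etime R k"
      using that K[of s] etime_mono[of k s] now(1) by auto
    then show ?thesis using assms(2) by (auto simp: timeout_step_def)
  qed
  have "received R k i (proposer R u) (Proposal u (proposal R u))" if u: "1 \<le> u" "u \<le> v" for u
  proof (rule received_bounded[OF \<open>k \<le> K\<close> prefix_received[OF i u K]])
    \<comment> \<open>Without deliveries, a proposal could arrive only by self-delivery in the step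
      that sends it, but all proposals up to view \<open>v\<close> are sent by \<beta>, strictly
      before this instant.\<close>
    fix s assume s: "k \<le> s" "s < K"
    show "\<not> receives R s i (proposer R u) (Proposal u (proposal R u))"
    proof
      assume "receives R s i (proposer R u) (Proposal u (proposal R u))"
      then have "proposal_step R u s (proposal R u)"
        using no_input[OF s] by (auto simp: receives_def input_def proposal_step_def)
      then have "etime R s = send_time R u" by (simp add: send_time_eq)
      then have "etime R s \<le> send_time R v"
        using prefix u unfolding prefix_extending_def by (cases "u = v") auto
      then show False using etime_mono[OF s(1)] now(2) by simp
    qed
  qed
  moreover have "\<not> positive_rule R k i e" for e
    using assms(2) bcast_legal(2)[OF ev] unfolding timeout_step_def positive_def by simp
  moreover have "core_ok R k i C"
    by (rule checks_without_input(1)[OF \<open>k \<le> K\<close> _ checks_at(1)[OF i K]]) (rule no_input)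
  moreover have "tip_ok R k i C T"
    by (rule checks_without_input(2)[OF \<open>k \<le> K\<close> _ checks_at(2)[OF i K]]) (rule no_input)
  ultimately have "echo_done R k i v"
    using echo_enabled[of k i] by blast
  then show False using echo_window(4) v' by simp
next
  case (echo_absent v')
  then have "v' = v" using m(2) by (auto simp: is_echo_response_def)
  then have "entered R k i v" "entry_clock R i v + 3 * max_delay R \<le> clock R i (etime R k)"
    using echo_absent by simp_all
  then show False
    using timeout_after_send[OF cutoff past(2,1) i, of k "3 * max_delay R"] late
      delay_le max_delay_pos by linarith
next
  case (no_ready v')
  then show False using m(2) by (auto simp: is_echo_response_def)
qed

text \<open>Quiescence at \<beta> + \<delta> yields some echo-stage response. Timeouts are excluded,
  and the only positive rule that responds sends grade 1 for the active proposal.\<close>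

lemma echo_sent:
  assumes i: "i \<in> parties R"
  shows "\<exists>s A w. sends R s i (Echo v Grade1 (C, T) A w) \<and> etime R s \<le> send_time R v + delay R"
proof -
  obtain K where K: "\<And>s. s < K \<longleftrightarrow> etime R s \<le> send_time R v + delay R"
    and quiet: "\<And>i e. i \<in> parties R \<Longrightarrow> \<not> positive_rule R K i e"
    using quiescent_after[of 1] by auto
  have "echo_done R K i v"
    using echo_enabled[of K i] quiet[OF i] prefix_received[OF i _ _ K] checks_at[OF i K] by blast
  then obtain s m where s: "s < K" "sends R s i m" "is_echo_response v m"
    by (auto simp: echo_done_def sent_def)
  have late: "etime R s \<le> send_time R v + delay R" using s(1) K by simp
  from s(2,3) show ?thesis
  proof (cases rule: echo_response_cases)
    case 1
    from this(1) s(3) have "\<exists>A w. m = Echo v Grade1 (C, T) A w"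
    proof cases
      case (echo v' C' T')
      then have "v' = v" using s(3) by (auto simp: is_echo_response_def)
      then show ?thesis using echo active_proposal_eq[of s i "(C', T')"] by simp
    qed (auto simp: is_echo_response_def)
    then show ?thesis using s(2) late by blast
  next
    case 2
    moreover have "event R s = Bcast i m"
      using s(2,3) by (auto simp: sends_def is_echo_response_def)
    ultimately show ?thesis using no_echo_timeout[OF i _ late] s(3) by blast
  qed
qed

text \<open>Since there is one response per view, the ECHO found by \<beta> + \<delta> is the only
  one, so the conclusion covers ECHOs sent at any time.\<close>

lemma echo_eq:
  assumes "sends R s i (Echo v g B A w)" "i \<in> parties R"
  shows "g = Grade1 \<and> B = (C, T)"
proof -
  obtain s' A' w' where "sends R s' i (Echo v Grade1 (C, T) A' w')"
    using echo_sent[OF assms(2)] by blast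
  from echo_response_unique[OF this _ assms(1), of v] show ?thesis
    by (auto simp: is_echo_response_def)
qed

lemma received_echo_eq:
  assumes "received R k i j (Echo v g B A w)" "j \<in> parties R"
  shows "g = Grade1 \<and> B = (C, T)"
  using received_imp_sent[OF assms(1)] echo_eq assms(2) unfolding sent_def by blast

lemma all_echoes_received:
  assumes i: "i \<in> parties R" and "\<And>s. s < K \<longleftrightarrow> etime R s \<le> send_time R v + 2 * delay R"
  shows "graded_echoes R K i v Grade1 (C, T) = nparties R"
proof -
  have "\<exists>A w. received R K i j (Echo v Grade1 (C, T) A w)" if j: "j \<in> parties R" for j
  proof -
    obtain s A w where s: "sends R s j (Echo v Grade1 (C, T) A w)" "etime R s \<le> send_time R v + delay R"
      using echo_sent[OF j] by blast
    then have "received R K i j (Echo v Grade1 (C, T) A w)"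
      using gst_le assms(2) delay_nonneg by (intro sent_imp_received[OF i j, of s]) auto
    then show ?thesis by blast
  qed
  then have "{j \<in> parties R. \<exists>A w. received R K i j (Echo v Grade1 (C, T) A w)} = parties R"
    by auto
  then show ?thesis by (simp add: graded_echoes_def)
qed

section \<open>The READY stage\<close>

lemma ready_eq:
  assumes "sends R s i (Ready v g B w)"
  shows "g = Homogeneous Grade1 \<and> B = (C, T)"
  using assms
\<comment> \<open>The induction deals with refinements: each needs an earlier mix READY of the same
  party, which the hypothesis excludes.\<close>
proof (induction s arbitrary: g B w rule: less_induct)
  case (less s)
  have ev: "event R s = Bcast i (Ready v g B w)"
    using less.prems by (auto simp: sends_def)
  have "\<not> timeout_step R s i"
    by (auto simp: timeout_step_def ev elim: timeout_bcastE split: if_splits)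
  moreover have "\<not> optional_step R s i (Bcast i (Ready v g B w))"
  proof
    assume "optional_step R s i (Bcast i (Ready v g B w))"
    then obtain w' where "sent R s i (Ready v Mix B w')"
      by (auto dest: optional_step_cases)
    then obtain s' where "s' < s" "sends R s' i (Ready v Mix B w')"
      by (auto simp: sent_def)
    then show False using less.IH by blast
  qed
  ultimately have "positive_rule R s i (Bcast i (Ready v g B w))"
    using bcast_legal(3)[OF ev] by blast
  then have q: "quorum R \<le> echoes R s i v B" and g: "g = initial_ready_grade R s i v B"
    by (cases, simp)+
  \<comment> \<open>A quorum is nonempty, so some counted ECHO names \<open>B\<close>, and every
    ECHO names (\<open>C\<close>, \<open>T\<close>).\<close>
  have "0 < card {j \<in> parties R. \<exists>g A w. received R s i j (Echo v g B A w)}"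
    using q quorum_pos unfolding echoes_def by linarith
  then have "{j \<in> parties R. \<exists>g A w. received R s i j (Echo v g B A w)} \<noteq> {}"
    by (metis card.empty less_irrefl)
  then have B: "B = (C, T)"
    using received_echo_eq by blast
  have "{j \<in> parties R. \<exists>g A w. received R s i j (Echo v g B A w)}
      = {j \<in> parties R. \<exists>A w. received R s i j (Echo v Grade1 B A w)}"
    using received_echo_eq by blast
  then have "quorum R \<le> graded_echoes R s i v Grade1 B"
    using q by (simp add: echoes_def graded_echoes_def)
  then show ?case
    using B g by (simp add: initial_ready_grade_def)
qed

lemma ready_sent:
  assumes i: "i \<in> parties R"
  shows "\<exists>s w. sends R s i (Ready v (Homogeneous Grade1) (C, T) w) \<and>
    etime R s \<le> send_time R v + 2 * delay R"
proof -
  obtain K where K: "\<And>s. s < K \<longleftrightarrow> etime R s \<le> send_time R v + 2 * delay R"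
    and quiet: "\<And>i e. i \<in> parties R \<Longrightarrow> \<not> positive_rule R K i e"
    using quiescent_after[of 2] by auto
  have "graded_echoes R K i v Grade1 (C, T) \<le> echoes R K i v (C, T)"
    unfolding graded_echoes_def echoes_def by (rule card_mono) auto
  then have "quorum R \<le> echoes R K i v (C, T)"
    using all_echoes_received[OF i K] quorum_le by simp
  then have "ready_done R K i v"
    using positive_rule.ready[of v R K i "(C, T)"] quiet[OF i] past(1) by blast
  then obtain s m where s: "s < K" "sends R s i m" "is_ready_response v m"
    by (auto simp: ready_done_def sent_def)
  have late: "etime R s \<le> send_time R v + 2 * delay R" using s(1) K by simp
  \<comment> \<open>Only a timeout sends \<open>NoReady\<close>, and the deadline 4\<Delta> after
    entry falls later than \<beta> + 2\<delta>.\<close>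
  have "m \<noteq> NoReady v w" for w
  proof
    assume m: "m = NoReady v w"
    then have ev: "event R s = Bcast i (NoReady v w)"
      using s(2) by (auto simp: sends_def)
    have "\<not> positive_rule R s i (Bcast i (NoReady v w))"
      by (auto elim: positive_bcastE)
    then have "timeout R s (etime R s) i (Bcast i (NoReady v w))"
      using bcast_legal(3)[OF ev] ev by (auto simp: timeout_step_def dest: optional_step_cases)
    then show False
    proof cases
      case no_ready
      then have "entered R s i v" "entry_clock R i v + 4 * max_delay R \<le> clock R i (etime R s)"
        by simp_all
      then show False
        using timeout_after_send[OF cutoff past(2,1) i, of s "4 * max_delay R"] late
          delay_le max_delay_pos by linarith
    qed (auto split: if_splits)
  qed
  then obtain g B w where "m = Ready v g B w"
    using s(3) by (auto simp: is_ready_response_def)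
  then show ?thesis using s(2) ready_eq late by blast
qed

section \<open>The ordinary and the fast result\<close>

lemma direct_result:
  assumes i: "i \<in> parties R"
  shows "occurs_by R (DirectResult i v (CommitFull C T)) (send_time R v + 3 * delay R)"
proof -
  obtain K where K: "\<And>s. s < K \<longleftrightarrow> etime R s \<le> send_time R v + 3 * delay R"
    and quiet: "\<And>i e. i \<in> parties R \<Longrightarrow> \<not> positive_rule R K i e"
    using quiescent_after[of 3] by auto
  have "\<exists>w. received R K i j (Ready v (Homogeneous Grade1) (C, T) w)" if j: "j \<in> parties R" for j
  proof -
    obtain s w where s: "sends R s j (Ready v (Homogeneous Grade1) (C, T) w)"
      "etime R s \<le> send_time R v + 2 * delay R"
      using ready_sent[OF j] by blast
    then have "received R K i j (Ready v (Homogeneous Grade1) (C, T) w)"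
      using gst_le K delay_nonneg by (intro sent_imp_received[OF i j, of s]) auto
    then show ?thesis by blast
  qed
  then have "{j \<in> parties R. \<exists>w. received R K i j (Ready v (Homogeneous Grade1) (C, T) w)} = parties R"
    by auto
  then have "quorum R \<le> graded_readies R K i v Grade1 (C, T)"
    using quorum_le by (simp add: graded_readies_def)
  then have "\<exists>s. s < K \<and> event R s = DirectResult i v (CommitFull C T)"
    using positive_rule.direct_full[of v K R i C T] quiet[OF i] past(1) by blast
  then show ?thesis using K by (auto simp: occurs_by_def)
qed

lemma fast_result:
  assumes i: "i \<in> parties R"
  shows "occurs_by R (EmitFast i v (CommitFull C T)) (send_time R v + 2 * delay R)"
    and "occurs_by R (SubmitFast i v (CommitFull C T)) (send_time R v + 2 * delay R)"
proof -
  obtain K where K: "\<And>s. s < K \<longleftrightarrow> etime R s \<le> send_time R v + 2 * delay R"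
    and quiet: "\<And>i e. i \<in> parties R \<Longrightarrow> \<not> positive_rule R K i e"
    using quiescent_after[of 2] by auto
  note n = all_echoes_received[OF i K]
  have "\<exists>s. s < K \<and> event R s = EmitFast i v (CommitFull C T)"
    using positive_rule.emit_fast[OF past(1) _ n] quiet[OF i] by blast
  then show "occurs_by R (EmitFast i v (CommitFull C T)) (send_time R v + 2 * delay R)"
    using K by (auto simp: occurs_by_def)
  have "\<exists>s. s < K \<and> event R s = SubmitFast i v (CommitFull C T)"
    using positive_rule.submit_fast[OF past(1) _ n] quiet[OF i] by blast
  then show "occurs_by R (SubmitFast i v (CommitFull C T)) (send_time R v + 2 * delay R)"
    using K by (auto simp: occurs_by_def)
qed

end

theorem lemmaB6:
  fixes R :: "('h, 'p) run" and V v :: view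
  assumes run: "all_correct_run R"
    and cutoff: "pacemaker_cutoff R V"
    and past: "1 \<le> v" "V \<le> v"
  shows
    "(\<forall>u \<ge> 1. \<exists>!(k, B). proposal_step R u k B) \<and>
     send_time R (v + 1) \<le> Max (send_time R ` {1..v}) + delay R \<and>
     (\<forall>t. least_unproposed R t = v + 1 \<longrightarrow> send_time R (v + 1) \<le> latest_send R t + delay R) \<and>
     (\<forall>C T. proposal R v = (C, T) \<and> prefix_extending R v \<and>
        (\<forall>i \<in> parties R. checks_pass_by R i C T (send_time R v + delay R)) \<longrightarrow>
        (\<forall>i \<in> parties R.
           occurs_by R (DirectResult i v (CommitFull C T)) (send_time R v + 3 * delay R) \<and>
           occurs_by R (EmitFast i v (CommitFull C T)) (send_time R v + 2 * delay R) \<and>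
           occurs_by R (SubmitFast i v (CommitFull C T)) (send_time R v + 2 * delay R)))"
proof -
  interpret correct_run R by unfold_locales (fact run)
  \<comment> \<open>An arbitrary upper bound of the send times serves both \<open>Max\<close> and
    \<open>latest_send\<close>; being at least \<beta> of view \<open>v\<close>, it is past the
    GST.\<close>
  have next_le: "send_time R (v + 1) \<le> t + delay R"
    if "\<And>u. 1 \<le> u \<Longrightarrow> u \<le> v \<Longrightarrow> send_time R u \<le> t" for t
  proof (rule next_send_time)
    show "gst R \<le> t"
      using that[OF past(1)] gst_le_send_time[OF cutoff past(2,1)] by simp
    show "0 \<le> t"
    proof -
      obtain k where "etime R k = send_time R v"
        using send_timeE[OF past(1)] by blast
      then show ?thesis using etime_nonneg[of k] that[OF past(1)] by simp
    qed
  qed (fact that)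
  have "send_time R (v + 1) \<le> Max (send_time R ` {1..v}) + delay R"
    by (rule next_le) (auto intro!: Max_ge)
  moreover have "send_time R (v + 1) \<le> latest_send R t + delay R"
    if least: "least_unproposed R t = v + 1" for t
  proof (rule next_le)
    fix u assume u: "1 \<le> u" "u \<le> v"
    let ?S = "{etime R k | k. etime R k \<le> t \<and> (\<exists>u \<ge> 1. \<exists>B. proposal_step R u k B)}"
    obtain k where k: "proposal_step R u k (proposal R u)" "etime R k = send_time R u"
      using send_timeE[OF u(1)] .
    \<comment> \<open>Views below the least unproposed one have been sent by \<open>t\<close>, so
      their sends are among those that \<open>latest_send\<close> maximizes over.\<close>
    have "u < (LEAST w. 1 \<le> w \<and> \<not> (\<exists>k B. proposal_step R w k B \<and> etime R k \<le> t))"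
      using least u(2) by (simp add: least_unproposed_def)
    from not_less_Least[OF this] have "send_time R u \<le> t"
      using u(1) send_time_eq by auto
    then have "etime R k \<le> t" using k(2) by simp
    then have "etime R k \<in> ?S" using k(1) u(1) by blast
    then have "send_time R u \<in> ?S" using k(2) by simp
    \<comment> \<open>\<open>Max\<close> needs finiteness: only finitely many steps happen up to
      \<open>t\<close>, and none at negative times, for which \<open>quiescent\<close> gives no
      cut.\<close>
    moreover have "finite ?S"
    proof (cases "0 \<le> t")
      case True
      then obtain K where "\<And>s. s < K \<longleftrightarrow> etime R s \<le> t"
        by (rule quiescent) (rule that)
      then have "?S \<subseteq> etime R ` {..<K}" by auto
      then show ?thesis by (rule finite_subset) simp
    next
      case False
      then have "\<not> etime R k \<le> t" for k using etime_nonneg[of k] by simp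
      then show ?thesis by simp
    qed
    ultimately show "send_time R u \<le> latest_send R t"
      unfolding latest_send_def by (intro Max_ge)
  qed
  moreover have "occurs_by R (DirectResult i v (CommitFull C T)) (send_time R v + 3 * delay R) \<and>
      occurs_by R (EmitFast i v (CommitFull C T)) (send_time R v + 2 * delay R) \<and>
      occurs_by R (SubmitFast i v (CommitFull C T)) (send_time R v + 2 * delay R)"
    if "proposal R v = (C, T)" "prefix_extending R v"
      "\<forall>i \<in> parties R. checks_pass_by R i C T (send_time R v + delay R)" "i \<in> parties R" for C T i
  proof -
    interpret prefix_extending_view R V v C T
      using that cutoff past by unfold_locales auto
    show ?thesis using direct_result fast_result \<open>i \<in> parties R\<close> by blast
  qed
  ultimately show ?thesis
    using proposal_ex1 by blast
qed

end
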